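(* Let $d\ge1$ and let $u_1,\dots,u_{d+1}:\mathbb{R}^d\times\mathbb{R}\to\mathbb{C}$ be solutions of the Schr\"odinger equation $i\partial_tu=\Delta u$ with initial data $f_1,\dots,f_{d+1}$ respectively. Then $$\int_{\substack{x_1+\cdots+x_{d+1}=0\\ t_1+\cdots+t_{d+1}=0}}\bigl||\rho(\nabla_x)|^{1/2}\bigl(u_1(x_1,t_1)\cdots u_{d+1}(x_{d+1},t_{d+1})\bigr)\bigr|^2\,dx\,dt=\frac{1}{2^d}\|f_1\|_{L^2(\mathbb{R}^d)}^2\cdots\|f_{d+1}\|_{L^2(\mathbb{R}^d)}^2 .$$
   Context: Fourier transform: $\widehat f(\xi)=\int_{\mathbb{R}^d}e^{-ix\cdot\xi}f(x)\,dx$. The data $f_j$ are such that $\widehat f_j\in L^1(\mathbb{R}^d)$ (with $f_j$ the inverse Fourier transform of $\widehat f_j$) and $|\rho(\xi)|^{1/2}\widehat f_1(\xi_1)\cdots\widehat f_{d+1}(\xi_{d+1})$ is integrable on $(\mathbb{R}^d)^{d+1}$. The solution with data $f_j$ is $u_j(x,t)=(2\pi)^{-d}\int_{\mathbb{R}^d}e^{i(x\cdot\xi+t|\xi|^2)}\widehat f_j(\xi)\,d\xi$. For $\xi=(\xi_1,\dots,\xi_{d+1})\in(\mathbb{R}^d)^{d+1}$, $$\rho(\xi)=\det\begin{pmatrix}1&\cdots&1\\ \xi_1&\cdots&\xi_{d+1}\end{pmatrix},$$ the determinant of the $(d+1)\times(d+1)$ matrix with $j$-th column $(1,\xi_j)^T$.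 The operator $|\rho(\nabla_x)|^{1/2}$ is the Fourier multiplier operator in the variables $(x_1,\dots,x_{d+1})\in\mathbb{R}^{d(d+1)}$ (with the times $t_j$ fixed) with multiplier $|\rho(\xi)|^{1/2}$; that is, $$|\rho(\nabla_x)|^{1/2}(u_1(x_1,t_1)\cdots u_{d+1}(x_{d+1},t_{d+1}))=(2\pi)^{-d(d+1)}\int_{(\mathbb{R}^d)^{d+1}}|\rho(\xi)|^{1/2}\prod_{j=1}^{d+1}e^{i(x_j\cdot\xi_j+t_j|\xi_j|^2)}\widehat f_j(\xi_j)\,d\xi .$$ It is applied first, and the result is then restricted to the subspace of integration. The integral over $x_1+\cdots+x_{d+1}=0$, $t_1+\cdots+t_{d+1}=0$ is with respect to $dx_1\cdots dx_d\,dt_1\cdots dt_d$, with $x_{d+1}=-x_1-\cdots-x_d$ and $t_{d+1}=-t_1-\cdots-t_d$. The identity is understood in $[0,\infty]$, with $\|f_j\|_{L^2}=\infty$ if $f_j\notin L^2$ and $0\cdot\infty=0$. *)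

theory Defs
  imports "HOL-Analysis.Analysis"
begin

definition inverse_fourier :: "('a::euclidean_space \<Rightarrow> complex) \<Rightarrow> 'a \<Rightarrow> complex" where
  "inverse_fourier g x =
     complex_of_real (1 / (2 * pi) ^ DIM('a)) * (\<integral>\<xi>. cis (x \<bullet> \<xi>) * g \<xi> \<partial>lborel)"

(* The convention is that of hat f(xi) = integral of e^(-i x.xi) f(x) dx. The functions treated here
   have an integrable Fourier transform but need not be integrable themselves (nor lie in L^2), so
   that integral may diverge; the transform is the L^1 function whose inverse transform is f. *)
definition has_fourier_transform ::
    "('a::euclidean_space \<Rightarrow> complex) \<Rightarrow> ('a \<Rightarrow> complex) \<Rightarrow> bool" where
  "has_fourier_transform f g \<longleftrightarrow>
     integrable lborel g \<and> (AE x in lborel. f x = inverse_fourier g x)"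

(* Determined up to null sets, by injectivity of the Fourier transform on L^1; only integrals
   against it are used. Arbitrary if f has no integrable Fourier transform. *)
definition fourier_transform :: "('a::euclidean_space \<Rightarrow> complex) \<Rightarrow> 'a \<Rightarrow> complex" where
  "fourier_transform f = (SOME g. has_fourier_transform f g)"

definition fourier_multiplier ::
    "('a::euclidean_space \<Rightarrow> complex) \<Rightarrow> ('a \<Rightarrow> complex) \<Rightarrow> 'a \<Rightarrow> complex" where
  "fourier_multiplier m U = inverse_fourier (\<lambda>\<xi>. m \<xi> * fourier_transform U \<xi>)"

(* The solution of i u_t = Laplacian u with u(.,0) = f. *)
definition schrodinger_solution ::
    "('a::euclidean_space \<Rightarrow> complex) \<Rightarrow> 'a \<Rightarrow> real \<Rightarrow> complex" where
  "schrodinger_solution f x t =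
     complex_of_real (1 / (2 * pi) ^ DIM('a)) *
     (\<integral>\<xi>. cis (x \<bullet> \<xi> + t * (norm \<xi>)\<^sup>2) * fourier_transform f \<xi> \<partial>lborel)"

(* The index set {1,...,d+1} is 'd option, with d = CARD('d) and None in the role of d+1. Column j
   of the matrix is (1, xi_j), the row of ones being row None. Placing that row and column last
   instead of first does not affect the determinant, as rows and columns are permuted alike. *)
definition rho :: "(real ^ 'd) ^ 'd option \<Rightarrow> real" where
  "rho \<xi> = det ((\<chi> i j. case i of None \<Rightarrow> 1 | Some k \<Rightarrow> \<xi> $ j $ k) :: real ^ 'd option ^ 'd option)"

definition abs_rho_nabla_half ::
    "((real ^ 'd) ^ 'd option \<Rightarrow> complex) \<Rightarrow> (real ^ 'd) ^ 'd option \<Rightarrow> complex" where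
  "abs_rho_nabla_half = fourier_multiplier (\<lambda>\<xi>. complex_of_real (\<bar>rho \<xi>\<bar> powr (1/2)))"

(* (y_1,...,y_d) maps to (y_1,...,y_d, -y_1-...-y_d), a parametrization of the subspace of
   (d+1)-tuples with sum 0. *)
definition zero_sum_ext :: "'b::ab_group_add ^ 'd \<Rightarrow> 'b ^ 'd option" where
  "zero_sum_ext y = (\<chi> j. case j of None \<Rightarrow> - (\<Sum>i\<in>UNIV. y $ i) | Some i \<Rightarrow> y $ i)"

(* The square of the L^2 norm, infinite if f is not in L^2. *)
definition L2_norm_sq :: "('a::euclidean_space \<Rightarrow> complex) \<Rightarrow> ennreal" where
  "L2_norm_sq f = (\<integral>\<^sup>+ x. ennreal ((norm (f x))\<^sup>2) \<partial>lborel)"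

end

theory Submission
  imports Defs "HOL-Probability.Characteristic_Functions"
begin

text \<open>
  On the subspace of integration the phase of the multiplier integral is
  \<open>\<Sum>\<^sub>i x\<^sub>i \<bullet> (\<xi>\<^sub>i - \<xi>\<^sub>d\<^sub>+\<^sub>1) + \<Sum>\<^sub>i t\<^sub>i (|\<xi>\<^sub>i|\<^sup>2 - |\<xi>\<^sub>d\<^sub>+\<^sub>1|\<^sup>2)\<close>, the sums being over \<open>i \<le> d\<close>. In the
  variables \<open>\<eta>\<^sub>i = \<xi>\<^sub>i - \<xi>\<^sub>d\<^sub>+\<^sub>1\<close> and \<open>\<tau>\<^sub>i = |\<xi>\<^sub>i|\<^sup>2 - |\<xi>\<^sub>d\<^sub>+\<^sub>1|\<^sup>2 = |\<eta>\<^sub>i|\<^sup>2 + 2 \<eta>\<^sub>i \<bullet> \<xi>\<^sub>d\<^sub>+\<^sub>1\<close>,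
  which are affine in \<open>\<xi>\<^sub>d\<^sub>+\<^sub>1\<close> for fixed \<open>\<eta>\<close>, it is an inverse Fourier transform in all
  \<open>d (d + 1)\<close> variables. The Jacobian is \<open>2\<^sup>d |det \<eta>| = 2\<^sup>d |\<rho>(\<xi>)|\<close>, so the weight \<open>|\<rho>|\<^sup>1\<^sup>/\<^sup>2\<close>
  is exactly what makes Plancherel's identity return \<open>2\<^sup>-\<^sup>d \<Prod> \<parallel>f\<^sub>j\<parallel>\<^sup>2\<close>.

  Plancherel's identity is needed in \<open>[0, \<infinity>]\<close> for every \<open>L\<^sup>1\<close> function. Inserting a Gaussian
  and using Fubini and the AM-GM inequality gives \<open>\<le>\<close>. Applied to the Gaussian-damped transform,
  whose transform is a mollification of the original function, this bound gives \<open>\<ge>\<close> by Fatou's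
  lemma.
\<close>

text \<open>The hypotheses place the weighted product of the transforms in L^1 and give no L^2
  bound, while both sides of the identity may be infinite. Extending Plancherel from L^2 by density
  would not cover this, hence a version for every L^1 function. The subspace of integration is a
  null set of R^(d(d+1)), so the result of the multiplier operator must be known at every point and
  not merely almost everywhere. It is, because each value is an integral against a transform, and
  changing the transform on a null set changes no value. Where det eta = 0, tau no longer determines
  xi_(d+1). This set is null and the weight vanishes on it, so weight over Jacobian can be read as 0
  there. Off it, only a linear change of variables for fixed eta is involved. All powers of 2 pi
  cancel: d^2 + d variables for Plancherel on the left, d + 1 times d variables for the norms of the
  f_j on the right.\<close>

subsection \<open>Translations in \<open>L\<^sup>1\<close>\<close>

lemma integral_lborel_affine:
  fixes f :: "'a::euclidean_space \<Rightarrow> 'b::{banach, second_countable_topology}"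
  assumes [measurable]: "f \<in> borel_measurable borel" and c: "c \<noteq> 0"
  shows "(\<integral>x. f x \<partial>lborel) = \<bar>c\<bar> ^ DIM('a) *\<^sub>R (\<integral>x. f (t + c *\<^sub>R x) \<partial>lborel)"
  by (subst lborel_affine[OF c, of t])
     (simp add: integral_density integral_distr)

lemma integrable_lborel_affine:
  fixes f :: "'a::euclidean_space \<Rightarrow> 'b::{banach, second_countable_topology}"
  assumes f: "integrable lborel f" and c: "c \<noteq> 0"
  shows "integrable lborel (\<lambda>x. f (t + c *\<^sub>R x))"
proof -
  have [measurable]: "f \<in> borel_measurable borel" using f by auto
  have "integrable (density (distr lborel borel (\<lambda>x. t + c *\<^sub>R x)) (\<lambda>_. ennreal (\<bar>c\<bar> ^ DIM('a)))) f"
    using f lborel_affine[OF c, of t] by simp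
  then have "integrable lborel (\<lambda>x. \<bar>c\<bar> ^ DIM('a) *\<^sub>R f (t + c *\<^sub>R x))"
    by (subst (asm) integrable_density) (auto simp: integrable_distr_eq)
  from integrable_scaleR_right[OF this, of "inverse (\<bar>c\<bar> ^ DIM('a))"]
  show ?thesis using c by simp
qed

lemma integrable_lborel_translate:
  fixes f :: "'a::euclidean_space \<Rightarrow> 'b::{banach, second_countable_topology}"
  assumes "integrable lborel f"
  shows "integrable lborel (\<lambda>x. f (x + t))"
  using integrable_lborel_affine[OF assms, of 1 t] by (simp add: add.commute)

lemma integral_lborel_translate:
  fixes f :: "'a::euclidean_space \<Rightarrow> 'b::{banach, second_countable_topology}"
  assumes [measurable]: "f \<in> borel_measurable borel"
  shows "(\<integral>x. f (x + t) \<partial>lborel) = (\<integral>x. f x \<partial>lborel)"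
  by (subst (2) lborel_distr_plus[of t, symmetric]) (simp add: integral_distr add.commute)

lemma nn_integral_lborel_translate:
  fixes f :: "'a::euclidean_space \<Rightarrow> ennreal"
  assumes [measurable]: "f \<in> borel_measurable borel"
  shows "(\<integral>\<^sup>+x. f (x + t) \<partial>lborel) = (\<integral>\<^sup>+x. f x \<partial>lborel)"
  by (subst (2) lborel_distr_plus[of t, symmetric]) (simp add: nn_integral_distr add.commute)

lemma nn_integral_lborel_uminus:
  fixes f :: "'a::euclidean_space \<Rightarrow> ennreal"
  assumes [measurable]: "f \<in> borel_measurable borel"
  shows "(\<integral>\<^sup>+x. f (- x) \<partial>lborel) = (\<integral>\<^sup>+x. f x \<partial>lborel)"
  by (subst (2) lborel_affine[of "-1" 0]) (simp_all add: nn_integral_distr nn_integral_density)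

text \<open>The L^1 modulus of continuity. Its limit 0 at \<open>h = 0\<close> is what makes
  Gaussian mollifications converge in L^1.\<close>

definition translation_modulus :: "('a::euclidean_space \<Rightarrow> complex) \<Rightarrow> 'a \<Rightarrow> real" where
  "translation_modulus g h = (\<integral>x. norm (g (x + h) - g x) \<partial>lborel)"

lemma translation_modulus_nonneg: "translation_modulus g h \<ge> 0"
  unfolding translation_modulus_def by simp

text \<open>Triangle inequality through \<open>g\<close>. The errors at \<open>x + h\<close> and at
  \<open>x\<close> have the same integral by translation invariance, whence the factor 2.\<close>

lemma translation_modulus_perturb:
  assumes f: "integrable lborel f" and g: "integrable lborel g"
  shows "translation_modulus f h \<le> translation_modulus g h + 2 * (\<integral>x. norm (f x - g x) \<partial>lborel)"
proof -
  note [simp] = integrable_lborel_translate[OF f] integrable_lborel_translate[OF g] f g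
  have [measurable]: "f \<in> borel_measurable borel" "g \<in> borel_measurable borel"
    using borel_measurable_integrable[OF f] borel_measurable_integrable[OF g] by auto
  have d: "integrable lborel (\<lambda>x. f x - g x)" by simp
  have d': "integrable lborel (\<lambda>x. f (x + h) - g (x + h))" by simp
  have "translation_modulus f h \<le>
     (\<integral>x. norm (g (x + h) - g x) + norm (f (x + h) - g (x + h)) + norm (f x - g x) \<partial>lborel)"
    unfolding translation_modulus_def
  proof (intro integral_mono)
    fix x
    have "f (x + h) - f x = (g (x + h) - g x) + (f (x + h) - g (x + h)) + - (f x - g x)" by simp
    also have "norm \<dots> \<le> norm ((g (x + h) - g x) + (f (x + h) - g (x + h))) + norm (f x - g x)"
      by (metis norm_triangle_ineq norm_minus_cancel)
    also have "norm ((g (x + h) - g x) + (f (x + h) - g (x + h)))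
        \<le> norm (g (x + h) - g x) + norm (f (x + h) - g (x + h))"
      by (rule norm_triangle_ineq)
    finally show "norm (f (x + h) - f x) \<le> norm (g (x + h) - g x) + norm (f (x + h) - g (x + h)) + norm (f x - g x)"
      by simp
  qed (auto intro!: Bochner_Integration.integrable_add integrable_norm)
  also have "\<dots> = translation_modulus g h + (\<integral>x. norm (f (x + h) - g (x + h)) \<partial>lborel)
      + (\<integral>x. norm (f x - g x) \<partial>lborel)"
    unfolding translation_modulus_def
    by (subst Bochner_Integration.integral_add
          | (intro Bochner_Integration.integrable_add integrable_norm; simp; fail))+ simp
  also have "(\<integral>x. norm (f (x + h) - g (x + h)) \<partial>lborel) = (\<integral>x. norm (f x - g x) \<partial>lborel)"
    by (rule integral_lborel_translate[of "\<lambda>x. norm (f x - g x)"]) simp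
  finally show ?thesis by simp
qed

text \<open>An L^1 error \<open>e\<close> costs at most \<open>2 * e\<close> uniformly in the shift,
  so a vanishing modulus passes to L^1 limits. This serves both the indicator case and the limit
  case of the induction below.\<close>

lemma translation_modulus_approx:
  assumes f: "integrable lborel f"
    and approx: "\<And>e. e > 0 \<Longrightarrow> \<exists>g. integrable lborel g \<and> (\<integral>x. norm (f x - g x) \<partial>lborel) \<le> e
                    \<and> (\<lambda>n. translation_modulus g (h n)) \<longlonglongrightarrow> 0"
  shows "(\<lambda>n. translation_modulus f (h n)) \<longlonglongrightarrow> 0"
proof (rule LIMSEQ_I)
  fix r :: real assume r: "r > 0"
  \<comment> \<open>With error \<open>r / 4\<close> the perturbation costs at most
    \<open>r / 2\<close>, which leaves \<open>r / 2\<close> for the modulus of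
    \<open>g\<close>.\<close>
  then obtain g where g: "integrable lborel g" "(\<integral>x. norm (f x - g x) \<partial>lborel) \<le> r / 4"
      "(\<lambda>n. translation_modulus g (h n)) \<longlonglongrightarrow> 0"
    using approx[of "r / 4"] by auto
  from LIMSEQ_D[OF g(3), of "r / 2"] r obtain N where
    N: "\<And>n. n \<ge> N \<Longrightarrow> norm (translation_modulus g (h n) - 0) < r / 2" by auto
  show "\<exists>no. \<forall>n\<ge>no. norm (translation_modulus f (h n) - 0) < r"
  proof (intro exI allI impI)
    fix n assume "n \<ge> N"
    then show "norm (translation_modulus f (h n) - 0) < r"
      using N[of n] translation_modulus_perturb[OF f g(1), of "h n"] g(2)
        translation_modulus_nonneg[of f "h n"] by auto
  qed
qed

text \<open>A point of an open set stays in it under small shifts, so the part of \<open>U\<close>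
  that is lost tends to 0 pointwise and is dominated by the indicator of \<open>U\<close>. The part
  gained has the same integral as the part lost.\<close>

lemma translation_modulus_open:
  fixes U :: "'a::euclidean_space set"
  assumes U: "open U" "emeasure lborel U < \<infinity>" and h: "h \<longlonglongrightarrow> 0"
  shows "(\<lambda>n. translation_modulus (\<lambda>x. indicator U x *\<^sub>R c) (h n)) \<longlonglongrightarrow> 0"
proof -
  have [measurable]: "U \<in> sets borel" using U by auto
  define i where "i x = (indicator U x :: real)" for x
  have i: "integrable lborel i" unfolding i_def using U by simp
  have [measurable]: "i \<in> borel_measurable borel" using i by auto
  \<comment> \<open>Only the loss is controlled pointwise: at a boundary point outside
    \<open>U\<close> the shifted point may enter \<open>U\<close> for infinitely many
    \<open>n\<close>, and the gain has no evident fixed majorant.\<close>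
  define m where "m n x = max (i x - i (x + h n)) 0" for n x
  have m_int: "integrable lborel (m n)" for n
    unfolding m_def by (rule Bochner_Integration.integrable_bound[OF i]) (auto simp: i_def indicator_def)
  have m_le: "norm (m n x) \<le> i x" for n x by (auto simp: m_def i_def indicator_def)
  have m_lim: "(\<lambda>n. m n x) \<longlonglongrightarrow> 0" for x
  proof (cases "x \<in> U")
    case True
    have "(\<lambda>n. x + h n) \<longlonglongrightarrow> x" using tendsto_add[OF tendsto_const h, of x] by simp
    then have "eventually (\<lambda>n. x + h n \<in> U) sequentially"
      using U True by (simp add: topological_tendstoD)
    then have "eventually (\<lambda>n. m n x = 0) sequentially"
      by eventually_elim (auto simp: m_def i_def)
    then show ?thesis by (rule tendsto_eventually)
  next
    case False then show ?thesis by (simp add: m_def i_def)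
  qed
  have lim: "(\<lambda>n. \<integral>x. m n x \<partial>lborel) \<longlonglongrightarrow> integral\<^sup>L lborel (\<lambda>x::'a. 0)"
    by (rule integral_dominated_convergence[where w=i]) (use i m_le m_lim m_int in auto)
  have eq: "translation_modulus (\<lambda>x. indicator U x *\<^sub>R c) (h n) = norm c * (2 * (\<integral>x. m n x \<partial>lborel))" for n
  proof -
    \<comment> \<open>This is |a - b| = 2 max(b - a, 0) + (a - b). The last difference integrates to
      0 by translation invariance.\<close>
    have "norm (indicator U (x + h n) *\<^sub>R c - indicator U x *\<^sub>R c)
        = norm c * (2 * m n x + (i (x + h n) - i x))" for x
      unfolding m_def i_def by (auto simp: indicator_def)
    then have "translation_modulus (\<lambda>x. indicator U x *\<^sub>R c) (h n) =
        norm c * (\<integral>x. 2 * m n x + (i (x + h n) - i x) \<partial>lborel)"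
      unfolding translation_modulus_def by simp
    also have "(\<integral>x. 2 * m n x + (i (x + h n) - i x) \<partial>lborel)
       = 2 * (\<integral>x. m n x \<partial>lborel) + ((\<integral>x. i (x + h n) \<partial>lborel) - (\<integral>x. i x \<partial>lborel))"
      using m_int i integrable_lborel_translate[OF i] by simp
    also have "(\<integral>x. i (x + h n) \<partial>lborel) = (\<integral>x. i x \<partial>lborel)"
      by (rule integral_lborel_translate) simp
    finally show ?thesis by simp
  qed
  have "(\<lambda>n. norm c * (2 * (\<integral>x. m n x \<partial>lborel))) \<longlonglongrightarrow> norm c * (2 * 0)"
    by (intro tendsto_intros) (use lim in simp)
  then show ?thesis by (simp add: eq)
qed

text \<open>Density argument: outer regularity replaces a measurable set by an open one at small L^1
  cost; sums and dominated limits carry the property to all integrable functions.\<close>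

lemma translation_modulus_tendsto:
  fixes g :: "'a::euclidean_space \<Rightarrow> complex"
  assumes "integrable lborel g" and h: "h \<longlonglongrightarrow> 0"
  shows "(\<lambda>n. translation_modulus g (h n)) \<longlonglongrightarrow> 0"
  using assms(1)
proof (induction rule: integrable_induct)
  case (base A c)
  have A[measurable]: "A \<in> sets borel" using base by simp
  show ?case
  proof (rule translation_modulus_approx)
    show "integrable lborel (\<lambda>x. indicator A x *\<^sub>R c)" using base by simp
    fix e :: real assume e: "e > 0"
    \<comment> \<open>The summand 1 keeps the quotient defined when \<open>c\<close> is 0.\<close>
    define e' where "e' = e / (norm c + 1)"
    have e': "e' > 0" unfolding e'_def using e by (simp add: add_nonneg_pos)
    obtain U where U: "open U" "A \<subseteq> U" "emeasure lborel (U - A) < e'"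
      using outer_regular_lborel[OF A e'] .
    have [measurable]: "U \<in> sets borel" using U by auto
    have "emeasure lborel U = emeasure lborel (A \<union> (U - A))" using U by (simp add: Un_absorb1)
    also have "\<dots> \<le> emeasure lborel A + emeasure lborel (U - A)" by (rule emeasure_subadditive) auto
    also have "\<dots> < \<infinity>" using base U(3) by (auto simp: less_top[symmetric] top_unique)
    finally have fin: "emeasure lborel U < \<infinity>" .
    have "(\<integral>x. norm (indicator A x *\<^sub>R c - indicator U x *\<^sub>R c) \<partial>lborel) = (\<integral>x. norm c * indicator (U - A) x \<partial>lborel)"
      using U(2) by (intro Bochner_Integration.integral_cong) (auto simp: indicator_def)
    also have "\<dots> = norm c * measure lborel (U - A)" by simp
    also have "measure lborel (U - A) \<le> e'"
      unfolding measure_def using U(3) e' by (intro enn2real_leI) auto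
    then have "norm c * measure lborel (U - A) \<le> norm c * e'" by (rule mult_left_mono) simp
    also have "\<dots> \<le> (norm c + 1) * e'" using e' by simp
    also have "\<dots> = e"
      unfolding e'_def using norm_ge_zero[of c] by (simp add: add_nonneg_eq_0_iff del: norm_ge_zero)
    finally show "\<exists>g. integrable lborel g \<and> (\<integral>x. norm (indicator A x *\<^sub>R c - g x) \<partial>lborel) \<le> e
                    \<and> (\<lambda>n. translation_modulus g (h n)) \<longlonglongrightarrow> 0"
      using translation_modulus_open[OF U(1) fin h, of c] fin
      by (intro exI[of _ "\<lambda>x. indicator U x *\<^sub>R c"]) simp
  qed
next
  case (add f g)
  note [simp] = add.hyps integrable_lborel_translate[OF add.hyps(1)] integrable_lborel_translate[OF add.hyps(2)]
  show ?case
  proof (rule Lim_null_comparison[OF always_eventually])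
    show "(\<lambda>n. translation_modulus f (h n) + translation_modulus g (h n)) \<longlonglongrightarrow> 0"
      using tendsto_add[OF add.IH] by simp
    show "\<forall>n. norm (translation_modulus (\<lambda>x. f x + g x) (h n)) \<le> translation_modulus f (h n) + translation_modulus g (h n)"
    proof
      fix n
      have "translation_modulus (\<lambda>x. f x + g x) (h n) \<le>
         (\<integral>x. norm (f (x + h n) - f x) + norm (g (x + h n) - g x) \<partial>lborel)"
        unfolding translation_modulus_def
        by (intro integral_mono) (auto simp: add_diff_add norm_triangle_ineq)
      also have "\<dots> = translation_modulus f (h n) + translation_modulus g (h n)"
        unfolding translation_modulus_def by simp
      finally show "norm (translation_modulus (\<lambda>x. f x + g x) (h n)) \<le> translation_modulus f (h n) + translation_modulus g (h n)"
        by (simp add: translation_modulus_nonneg)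
    qed
  qed
next
  case (lim f s)
  show ?case
  proof (rule translation_modulus_approx)
    have [measurable]: "f \<in> borel_measurable borel" "\<And>i. s i \<in> borel_measurable borel" using lim.hyps by auto
    have "(\<lambda>i. \<integral>x. norm (f x - s i x) \<partial>lborel) \<longlonglongrightarrow> integral\<^sup>L lborel (\<lambda>x::'a. 0)"
    \<comment> \<open>The induction rule supplies \<open>s i\<close> bounded by twice
      \<open>f\<close> in norm; the difference adds one more.\<close>
    proof (rule integral_dominated_convergence[where w="\<lambda>x. 3 * norm (f x)"])
      show "AE x in lborel. (\<lambda>i. norm (f x - s i x)) \<longlonglongrightarrow> 0"
        using lim.hyps(2) by (intro AE_I2 tendsto_norm_zero) (auto intro!: tendsto_eq_intros)
      show "AE x in lborel. norm (norm (f x - s i x)) \<le> 3 * norm (f x)" for i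
      proof (intro AE_I2)
        fix x
        have "norm (f x - s i x) \<le> norm (f x) + norm (s i x)" by (rule norm_triangle_ineq4)
        then show "norm (norm (f x - s i x)) \<le> 3 * norm (f x)" using lim.hyps(3)[of x i] by simp
      qed
    qed (use lim.hyps in auto)
    then have L: "(\<lambda>i. \<integral>x. norm (f x - s i x) \<partial>lborel) \<longlonglongrightarrow> 0" by simp
    fix e :: real assume "e > 0"
    from LIMSEQ_D[OF L this] obtain i where "(\<integral>x. norm (f x - s i x) \<partial>lborel) < e" by auto
    then show "\<exists>g. integrable lborel g \<and> (\<integral>x. norm (f x - g x) \<partial>lborel) \<le> e
                    \<and> (\<lambda>n. translation_modulus g (h n)) \<longlonglongrightarrow> 0"
      using lim.hyps(1) lim.IH by (intro exI[of _ "s i"]) auto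
  qed (rule lim.hyps)
qed

subsection \<open>Plancherel's identity\<close>

lemma nn_integral_fatou_bound:
  assumes [measurable]: "\<And>n::nat. u n \<in> borel_measurable M"
    and lim: "AE x in M. (\<lambda>n. u n x) \<longlonglongrightarrow> (v x :: ennreal)"
    and C: "\<And>n. (\<integral>\<^sup>+x. u n x \<partial>M) \<le> C"
  shows "(\<integral>\<^sup>+x. v x \<partial>M) \<le> C"
proof -
  have "(\<integral>\<^sup>+x. v x \<partial>M) = (\<integral>\<^sup>+x. liminf (\<lambda>n. u n x) \<partial>M)"
    using lim by (intro nn_integral_cong_AE) (auto elim!: eventually_mono simp: lim_imp_Liminf)
  also have "\<dots> \<le> liminf (\<lambda>n. \<integral>\<^sup>+x. u n x \<partial>M)" by (rule nn_integral_liminf) simp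
  also have "\<dots> \<le> limsup (\<lambda>n. \<integral>\<^sup>+x. u n x \<partial>M)" by (rule Liminf_le_Limsup) simp
  also have "\<dots> \<le> C" by (rule Limsup_bounded) (simp add: C)
  finally show ?thesis .
qed

section \<open>Fubini for bounded kernels\<close>

lemma integrable_kernel:
  fixes f :: "'a::euclidean_space \<Rightarrow> complex" and h :: "'b::euclidean_space \<Rightarrow> complex"
  assumes f: "integrable lborel f" and h: "integrable lborel h"
    and [measurable]: "case_prod k \<in> borel_measurable (lborel \<Otimes>\<^sub>M lborel)"
    and k: "\<And>x y. norm (k x y) \<le> 1"
  shows "integrable (lborel \<Otimes>\<^sub>M lborel) (\<lambda>(x, y). f x * (h y * k x y))"
proof (rule lborel_pair.Fubini_integrable)
  have [measurable]: "f \<in> borel_measurable borel" "h \<in> borel_measurable borel"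
    using borel_measurable_integrable[OF f] borel_measurable_integrable[OF h] by auto
  show "(\<lambda>(x, y). f x * (h y * k x y)) \<in> borel_measurable (lborel \<Otimes>\<^sub>M lborel)" by measurable
  have hk: "integrable lborel (\<lambda>y. h y * k x y)" for x
    by (rule Bochner_Integration.integrable_bound[OF h])
       (auto simp: norm_mult mult_left_le k)
  then show "AE x in lborel. integrable lborel (\<lambda>y. case (x, y) of (x, y) \<Rightarrow> f x * (h y * k x y))"
    by simp
  show "integrable lborel (\<lambda>x. \<integral>y. norm (case (x, y) of (x, y) \<Rightarrow> f x * (h y * k x y)) \<partial>lborel)"
  proof (rule Bochner_Integration.integrable_bound)
    show "integrable lborel (\<lambda>x. (\<integral>y. norm (h y) \<partial>lborel) * norm (f x))"
      using f by simp
    show "AE x in lborel. norm (\<integral>y. norm (case (x, y) of (x, y) \<Rightarrow> f x * (h y * k x y)) \<partial>lborel)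
            \<le> norm ((\<integral>y. norm (h y) \<partial>lborel) * norm (f x))"
    proof (rule AE_I2)
      fix x
      have "(\<integral>y. norm (h y * k x y) \<partial>lborel) \<le> (\<integral>y. norm (h y) \<partial>lborel)"
        by (intro integral_mono integrable_norm hk h) (simp add: norm_mult mult_left_le k)
      then have "norm (f x) * (\<integral>y. norm (h y * k x y) \<partial>lborel) \<le> norm (f x) * (\<integral>y. norm (h y) \<partial>lborel)"
        by (rule mult_left_mono) simp
      then show "norm (\<integral>y. norm (case (x, y) of (x, y) \<Rightarrow> f x * (h y * k x y)) \<partial>lborel)
            \<le> norm ((\<integral>y. norm (h y) \<partial>lborel) * norm (f x))"
        by (simp add: norm_mult[of "f x"] mult.commute)
    qed
  qed measurable
qed

text \<open>For exponential \<open>k\<close> this is the multiplication formula, which moves the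
  transform from one factor to the other. The majorant for Fubini is |f(x)| |h(y)|.\<close>

lemma integral_kernel_swap:
  fixes f :: "'a::euclidean_space \<Rightarrow> complex" and h :: "'b::euclidean_space \<Rightarrow> complex"
  assumes f: "integrable lborel f" and h: "integrable lborel h"
    and k: "case_prod k \<in> borel_measurable (lborel \<Otimes>\<^sub>M lborel)" "\<And>x y. norm (k x y) \<le> 1"
  shows "(\<integral>x. f x * (\<integral>y. h y * k x y \<partial>lborel) \<partial>lborel) = (\<integral>y. h y * (\<integral>x. f x * k x y \<partial>lborel) \<partial>lborel)"
proof -
  have "(\<integral>x. f x * (\<integral>y. h y * k x y \<partial>lborel) \<partial>lborel) = (\<integral>x. (\<integral>y. f x * (h y * k x y) \<partial>lborel) \<partial>lborel)"
    by simp
  also have "\<dots> = (\<integral>y. (\<integral>x. f x * (h y * k x y) \<partial>lborel) \<partial>lborel)"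
    by (rule lborel_pair.Fubini_integral[symmetric]) (rule integrable_kernel[OF assms])
  also have "\<dots> = (\<integral>y. h y * (\<integral>x. f x * k x y \<partial>lborel) \<partial>lborel)"
  proof -
    have "f x * (h y * k x y) = h y * (f x * k x y)" for x y by simp
    then show ?thesis by (simp only: integral_mult_right_zero)
  qed
  finally show ?thesis .
qed

section \<open>Exponentials, the Gaussian and its transform\<close>

lemma cis_sum: "cis (\<Sum>i\<in>I. f i) = (\<Prod>i\<in>I. cis (f i))"
  by (induction I rule: infinite_finite_induct) (auto simp flip: cis_mult)

lemma measurable_cis[measurable (raw)]:
  "f \<in> borel_measurable M \<Longrightarrow> (\<lambda>x. cis (f x)) \<in> borel_measurable M"
  unfolding cis_conv_exp by measurable

text \<open>The product form lets the integral and the transform factor into facts about the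
  one-dimensional normal distribution.\<close>

definition gauss :: "'a::euclidean_space \<Rightarrow> real" where
  "gauss x = (\<Prod>b\<in>Basis. std_normal_density (x \<bullet> b))"

lemma gauss_measurable[measurable]: "gauss \<in> borel_measurable borel"
  unfolding gauss_def by measurable

lemma gauss_eq:
  "gauss (x::'a::euclidean_space) = exp (- (norm x)\<^sup>2 / 2) / sqrt (2 * pi) ^ DIM('a)"
proof -
  have "gauss x = (\<Prod>b\<in>(Basis::'a set). exp (- (x \<bullet> b)\<^sup>2 / 2) / sqrt (2 * pi))"
    unfolding gauss_def by (simp add: std_normal_density_def)
  also have "\<dots> = exp (\<Sum>b\<in>(Basis::'a set). - (x \<bullet> b)\<^sup>2 / 2) / sqrt (2 * pi) ^ DIM('a)"
    by (simp add: prod_dividef exp_sum)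
  also have "(\<Sum>b\<in>(Basis::'a set). - (x \<bullet> b)\<^sup>2 / 2) = - (norm x)\<^sup>2 / 2"
    unfolding power2_norm_eq_inner euclidean_inner[of x x]
    by (simp add: sum_divide_distrib sum_negf power2_eq_square)
  finally show ?thesis .
qed

lemma gauss_nonneg: "0 \<le> gauss x"
  unfolding gauss_eq by simp

lemma integrable_lborel_Basis_prod:
  fixes f :: "'a::euclidean_space \<Rightarrow> real \<Rightarrow> 'b::{real_normed_field,banach,second_countable_topology}"
  assumes "\<And>b. b \<in> Basis \<Longrightarrow> integrable lborel (f b)"
  shows "integrable lborel (\<lambda>x. \<Prod>b\<in>Basis. f b (x \<bullet> b))"
    and "(\<integral>x. (\<Prod>b\<in>Basis. f b (x \<bullet> b)) \<partial>lborel) = (\<Prod>b\<in>Basis. \<integral>x. f b x \<partial>lborel)"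
proof -
  interpret product_sigma_finite "\<lambda>_::'a. lborel :: real measure"
    by standard
  have [measurable]: "f b \<in> borel_measurable borel" if "b \<in> Basis" for b
    using borel_measurable_integrable[OF assms[OF that]] by simp
  have [measurable]: "(\<lambda>g. \<Sum>b\<in>Basis. g b *\<^sub>R b) \<in> measurable (Pi\<^sub>M Basis (\<lambda>_::'a. lborel :: real measure)) borel"
    by measurable
  have eq: "(\<lambda>g. \<Prod>b\<in>Basis. f b ((\<Sum>b\<in>Basis. g b *\<^sub>R b) \<bullet> b)) = (\<lambda>g. \<Prod>b\<in>Basis. f b (g b))"
    by simp
  show "integrable lborel (\<lambda>x. \<Prod>b\<in>Basis. f b (x \<bullet> b))"
    unfolding lborel_eq[where 'a='a]
    by (subst integrable_distr_eq) (auto simp: eq intro!: product_integrable_prod assms)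
  show "(\<integral>x. (\<Prod>b\<in>Basis. f b (x \<bullet> b)) \<partial>lborel) = (\<Prod>b\<in>Basis. \<integral>x. f b x \<partial>lborel)"
    unfolding lborel_eq[where 'a='a]
    by (subst integral_distr) (auto simp: eq intro!: product_integral_prod assms)
qed

lemma integrable_gauss: "integrable lborel (gauss :: 'a::euclidean_space \<Rightarrow> real)"
  and integral_gauss: "(\<integral>x. gauss (x::'a::euclidean_space) \<partial>lborel) = 1"
proof -
  have "integrable lborel std_normal_density" "(\<integral>x. std_normal_density x \<partial>lborel) = 1"
    by simp_all
  then show "integrable lborel (gauss :: 'a \<Rightarrow> real)" "(\<integral>x. gauss (x::'a) \<partial>lborel) = 1"
    unfolding gauss_def
    using integrable_lborel_Basis_prod[of "\<lambda>_::'a. std_normal_density"] by auto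
qed

lemma nn_integral_gauss: "(\<integral>\<^sup>+x. ennreal (gauss (x::'a::euclidean_space)) \<partial>lborel) = 1"
  by (subst nn_integral_eq_integral[OF integrable_gauss]) (simp_all add: integral_gauss gauss_nonneg)

text \<open>Both the density and the exponential factor over the coordinates, and each factor is the
  characteristic function of the standard normal distribution.\<close>

lemma integral_cis_gauss:
  fixes z :: "'a::euclidean_space"
  shows "(\<integral>x. complex_of_real (gauss x) * cis (x \<bullet> z) \<partial>lborel) =
     complex_of_real (sqrt (2 * pi) ^ DIM('a) * gauss z)"
proof -
  define f where "f b x = complex_of_real (std_normal_density x) * cis (x * (z \<bullet> b))" for b :: 'a and x
  have int: "integrable lborel (f b)" for b
  proof -
    have "integrable lborel std_normal_density" using integrable_std_normal_moment[of 0] by auto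
    then show ?thesis
      unfolding f_def by (rule Bochner_Integration.integrable_bound) (auto simp: norm_mult)
  qed
  have one: "(\<integral>x. f b x \<partial>lborel) = complex_of_real (exp (- (z \<bullet> b)\<^sup>2 / 2))" for b
  proof -
    have "complex_of_real (exp (- (z \<bullet> b)\<^sup>2 / 2)) = char std_normal_distribution (z \<bullet> b)"
      by (simp add: char_std_normal_distribution)
    also have "\<dots> = (\<integral>x. f b x \<partial>lborel)"
      unfolding char_def f_def
      by (subst integral_density) (auto simp: scaleR_conv_of_real cis_conv_exp mult.commute mult.left_commute)
    finally show ?thesis by simp
  qed
  have "complex_of_real (gauss x) * cis (x \<bullet> z) = (\<Prod>b\<in>Basis. f b (x \<bullet> b))" for x
    unfolding gauss_def f_def euclidean_inner[of x z]
    by (simp add: prod.distrib cis_sum)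
  then have "(\<integral>x. complex_of_real (gauss x) * cis (x \<bullet> z) \<partial>lborel) = (\<Prod>b\<in>Basis. \<integral>x. f b x \<partial>lborel)"
    using integrable_lborel_Basis_prod(2)[of f] int by simp
  also have "\<dots> = complex_of_real (\<Prod>b\<in>(Basis::'a set). exp (- (z \<bullet> b)\<^sup>2 / 2))"
    unfolding one by simp
  also have "(\<Prod>b\<in>(Basis::'a set). exp (- (z \<bullet> b)\<^sup>2 / 2)) = sqrt (2 * pi) ^ DIM('a) * gauss z"
    unfolding gauss_def by (simp add: std_normal_density_def prod_dividef)
  finally show ?thesis .
qed

text \<open>The sign of the exponent is that of \<open>inverse_fourier\<close>; only the normalising
  constant is left out.\<close>

definition ft :: "('a::euclidean_space \<Rightarrow> complex) \<Rightarrow> 'a \<Rightarrow> complex" where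
  "ft g x = (\<integral>\<xi>. g \<xi> * cis (x \<bullet> \<xi>) \<partial>lborel)"

lemma ft_measurable[measurable]:
  assumes [measurable]: "g \<in> borel_measurable borel"
  shows "ft g \<in> borel_measurable borel"
proof -
  have "(\<lambda>x. \<integral>\<xi>. g \<xi> * cis (x \<bullet> \<xi>) \<partial>lborel) \<in> borel_measurable borel" by measurable
  then show ?thesis by (simp add: ft_def[abs_def])
qed

lemma norm_ft_le: "norm (ft g x) \<le> (\<integral>\<xi>. norm (g \<xi>) \<partial>lborel)"
proof -
  have "norm (ft g x) \<le> (\<integral>\<xi>. norm (g \<xi> * cis (x \<bullet> \<xi>)) \<partial>lborel)"
    unfolding ft_def by (rule integral_norm_bound)
  then show ?thesis by (simp add: norm_mult)
qed

section \<open>Gaussian damping and mollification\<close>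

lemma integrable_gauss_scale:
  fixes s :: real assumes "s \<noteq> 0"
  shows "integrable lborel (\<lambda>x::'a::euclidean_space. gauss (s *\<^sub>R x))"
  using integrable_lborel_affine[OF integrable_gauss assms, of 0] by simp

lemma integrable_gauss_ft:
  fixes g :: "'a::euclidean_space \<Rightarrow> complex"
  assumes g: "integrable lborel g" and s: "s \<noteq> 0"
  shows "integrable lborel (\<lambda>x. complex_of_real (gauss (s *\<^sub>R x)) * ft g x)"
proof (rule Bochner_Integration.integrable_bound)
  have [measurable]: "g \<in> borel_measurable borel" using borel_measurable_integrable[OF g] by simp
  show "integrable lborel (\<lambda>x::'a. (\<integral>\<xi>. norm (g \<xi>) \<partial>lborel) * gauss (s *\<^sub>R x))"
    by (intro integrable_mult_right integrable_gauss_scale s)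
  show "(\<lambda>x. complex_of_real (gauss (s *\<^sub>R x)) * ft g x) \<in> borel_measurable lborel" by measurable
  show "AE x in lborel. norm (complex_of_real (gauss (s *\<^sub>R x)) * ft g x)
      \<le> norm ((\<integral>\<xi>. norm (g \<xi>) \<partial>lborel) * gauss (s *\<^sub>R x))"
    by (intro AE_I2)
       (simp add: norm_mult gauss_nonneg mult.commute[of _ "gauss _"] mult_left_mono norm_ft_le)
qed

text \<open>Convolution with the Gaussian of width \<open>s\<close>, rescaled so that the weight
  does not depend on \<open>s\<close>; this suits dominated convergence as \<open>s\<close> tends to
  0.\<close>

definition mollify :: "real \<Rightarrow> ('a::euclidean_space \<Rightarrow> complex) \<Rightarrow> 'a \<Rightarrow> complex" where
  "mollify s g \<xi> = (\<integral>z. g (\<xi> + s *\<^sub>R z) * complex_of_real (gauss z) \<partial>lborel)"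

lemma mollify_measurable[measurable]:
  assumes [measurable]: "g \<in> borel_measurable borel"
  shows "mollify s g \<in> borel_measurable borel"
proof -
  have "(\<lambda>\<xi>. \<integral>z. g (\<xi> + s *\<^sub>R z) * complex_of_real (gauss z) \<partial>lborel) \<in> borel_measurable borel" by measurable
  then show ?thesis by (simp add: mollify_def[abs_def])
qed

text \<open>Fourier inversion in regularised form. After Fubini the inner integral is the transform
  of a dilated Gaussian at \<eta> - \<xi>, hence again a Gaussian. The substitution \<eta> = \<xi> +
  s z makes it independent of \<open>s\<close>.\<close>

lemma ft_gauss_ft:
  fixes g :: "'a::euclidean_space \<Rightarrow> complex"
  assumes g: "integrable lborel g" and s: "s > 0"
  shows "ft (\<lambda>x. complex_of_real (gauss (s *\<^sub>R x)) * ft g x) (- \<xi>)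
     = complex_of_real (sqrt (2 * pi) ^ DIM('a)) * mollify s g \<xi>"
proof -
  have [measurable]: "g \<in> borel_measurable borel" using borel_measurable_integrable[OF g] by simp
  define G where "G x = complex_of_real (gauss (s *\<^sub>R x))" for x :: 'a
  have G[measurable]: "G \<in> borel_measurable borel" unfolding G_def by measurable
  have Gi: "integrable lborel (\<lambda>x. G x * cis (- (x \<bullet> \<xi>)))"
    by (rule Bochner_Integration.integrable_bound[OF integrable_gauss_scale[of s]])
       (use s in \<open>auto simp: norm_mult G_def\<close>)
  \<comment> \<open>Dilating the integration variable by \<open>s\<close> in
    \<open>integral_cis_gauss\<close> produces the power of \<open>s\<close>; below it cancels
    against the Jacobian of the substitution for \<eta>.\<close>
  have kern: "(\<integral>x. G x * cis (x \<bullet> (s *\<^sub>R z)) \<partial>lborel) * complex_of_real (s ^ DIM('a)) =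
     complex_of_real (sqrt (2 * pi) ^ DIM('a) * gauss z)" for z
  proof -
    have "complex_of_real (sqrt (2 * pi) ^ DIM('a) * gauss z) = (\<integral>x. complex_of_real (gauss x) * cis (x \<bullet> z) \<partial>lborel)"
      by (simp add: integral_cis_gauss)
    also have "\<dots> = \<bar>s\<bar> ^ DIM('a) *\<^sub>R (\<integral>x. complex_of_real (gauss (0 + s *\<^sub>R x)) * cis ((0 + s *\<^sub>R x) \<bullet> z) \<partial>lborel)"
      by (rule integral_lborel_affine) (use s in auto)
    also have "\<dots> = (\<integral>x. G x * cis (x \<bullet> (s *\<^sub>R z)) \<partial>lborel) * complex_of_real (s ^ DIM('a))"
      using s by (simp add: G_def scaleR_conv_of_real mult.commute)
    finally show ?thesis by simp
  qed
  have "ft (\<lambda>x. G x * ft g x) (- \<xi>) = (\<integral>x. (G x * cis (- (x \<bullet> \<xi>))) * (\<integral>\<eta>. g \<eta> * cis (x \<bullet> \<eta>) \<partial>lborel) \<partial>lborel)"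
    unfolding ft_def by (simp add: mult_ac inner_commute)
  also have "\<dots> = (\<integral>\<eta>. g \<eta> * (\<integral>x. (G x * cis (- (x \<bullet> \<xi>))) * cis (x \<bullet> \<eta>) \<partial>lborel) \<partial>lborel)"
    by (rule integral_kernel_swap[OF Gi g]) auto
  also have "\<dots> = (\<integral>\<eta>. g \<eta> * (\<integral>x. G x * cis (x \<bullet> (\<eta> - \<xi>)) \<partial>lborel) \<partial>lborel)"
    by (simp add: mult.assoc cis_mult inner_diff_right add.commute)
  also have "\<dots> = \<bar>s\<bar> ^ DIM('a) *\<^sub>R
      (\<integral>z. g (\<xi> + s *\<^sub>R z) * (\<integral>x. G x * cis (x \<bullet> ((\<xi> + s *\<^sub>R z) - \<xi>)) \<partial>lborel) \<partial>lborel)"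
    by (rule integral_lborel_affine) (use s in auto)
  also have "\<dots> = (\<integral>z. g (\<xi> + s *\<^sub>R z) *
      ((\<integral>x. G x * cis (x \<bullet> (s *\<^sub>R z)) \<partial>lborel) * complex_of_real (s ^ DIM('a))) \<partial>lborel)"
    using s by (simp add: scaleR_conv_of_real mult_ac del: inner_scaleR_right flip: integral_mult_right_zero)
  also have "\<dots> = (\<integral>z. complex_of_real (sqrt (2 * pi) ^ DIM('a)) * (g (\<xi> + s *\<^sub>R z) * complex_of_real (gauss z)) \<partial>lborel)"
    unfolding kern by (simp add: mult_ac)
  also have "\<dots> = complex_of_real (sqrt (2 * pi) ^ DIM('a)) * mollify s g \<xi>"
    unfolding mollify_def by (rule integral_mult_right_zero)
  finally show ?thesis unfolding G_def .
qed

section \<open>The upper bound in Plancherel's identity\<close>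

lemma ennreal_norm_integral_le:
  fixes f :: "'a \<Rightarrow> 'b::{banach, second_countable_topology}"
  shows "ennreal (norm (\<integral>x. f x \<partial>M)) \<le> (\<integral>\<^sup>+x. ennreal (norm (f x)) \<partial>M)"
  by (cases "integrable M f") (auto simp: integral_norm_bound_ennreal not_integrable_integral_eq)

lemma gauss_le_1: "gauss (x :: 'a::euclidean_space) \<le> 1"
proof -
  have "1 \<le> sqrt (2 * pi) ^ DIM('a)" using pi_gt3 by (intro one_le_power) simp
  moreover have "exp (- (norm x)\<^sup>2 / 2) \<le> 1" by simp
  ultimately have "exp (- (norm x)\<^sup>2 / 2) / sqrt (2 * pi) ^ DIM('a) \<le> 1 / 1"
    by (intro frac_le) auto
  then show ?thesis by (simp add: gauss_eq)
qed

text \<open>Damping makes the square of the transform integrable, so one factor can be expanded and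
  the integrals exchanged. By \<open>ft_gauss_ft\<close> this pairs \<open>g\<close> with its own
  mollification. The resulting constant does not depend on \<open>s\<close>, which permits the limit
  afterwards.\<close>

lemma plancherel_upper_gauss:
  fixes g :: "'a::euclidean_space \<Rightarrow> complex"
  assumes g: "integrable lborel g" and s: "s > 0"
  shows "(\<integral>\<^sup>+x. ennreal (gauss (s *\<^sub>R x) * (norm (ft g x))\<^sup>2) \<partial>lborel)
     \<le> ennreal (sqrt (2 * pi) ^ DIM('a)) * (\<integral>\<^sup>+\<xi>. ennreal ((norm (g \<xi>))\<^sup>2) \<partial>lborel)"
proof -
  have [measurable]: "g \<in> borel_measurable borel" using borel_measurable_integrable[OF g] by simp
  define G where "G x = complex_of_real (gauss (s *\<^sub>R x))" for x :: 'a
  have [measurable]: "G \<in> borel_measurable borel" unfolding G_def by measurable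
  have Gf: "integrable lborel (\<lambda>x. G x * ft g x)"
    unfolding G_def using integrable_gauss_ft[OF g] s by simp
  have cg: "integrable lborel (\<lambda>\<xi>. cnj (g \<xi>))" using g by simp
  define c where "c = sqrt (2 * pi) ^ DIM('a)"
  have c: "c \<ge> 0" by (simp add: c_def)
  have cnj_ft: "cnj (ft g x) = (\<integral>\<xi>. cnj (g \<xi>) * cis (- (x \<bullet> \<xi>)) \<partial>lborel)" for x
    unfolding ft_def by (subst Bochner_Integration.integral_cnj[symmetric]) (simp add: cis_cnj)
  have eq: "complex_of_real (gauss (s *\<^sub>R x) * (norm (ft g x))\<^sup>2) = G x * ft g x * cnj (ft g x)" for x
    unfolding G_def by (simp add: mult.assoc flip: complex_norm_square)
  \<comment> \<open>One factor \<open>ft g\<close> is bounded by the L^1 norm of \<open>g\<close>,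
    so the damped first power controls the damped square.\<close>
  have int: "integrable lborel (\<lambda>x. gauss (s *\<^sub>R x) * (norm (ft g x))\<^sup>2)"
  proof (rule Bochner_Integration.integrable_bound)
    show "integrable lborel (\<lambda>x. (\<integral>\<xi>. norm (g \<xi>) \<partial>lborel) * norm (G x * ft g x))"
      using Gf by (intro integrable_mult_right integrable_norm)
    show "AE x in lborel. norm (gauss (s *\<^sub>R x) * (norm (ft g x))\<^sup>2)
        \<le> norm ((\<integral>\<xi>. norm (g \<xi>) \<partial>lborel) * norm (G x * ft g x))"
    proof (rule AE_I2)
      fix x
      have "norm (ft g x) * (norm (G x) * norm (ft g x)) \<le> (\<integral>\<xi>. norm (g \<xi>) \<partial>lborel) * (norm (G x) * norm (ft g x))"
        by (intro mult_right_mono norm_ft_le) simp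
      then show "norm (gauss (s *\<^sub>R x) * (norm (ft g x))\<^sup>2)
        \<le> norm ((\<integral>\<xi>. norm (g \<xi>) \<partial>lborel) * norm (G x * ft g x))"
        by (simp add: G_def norm_mult gauss_nonneg power2_eq_square mult_ac)
    qed
  qed measurable
  have "complex_of_real (\<integral>x. gauss (s *\<^sub>R x) * (norm (ft g x))\<^sup>2 \<partial>lborel)
      = (\<integral>x. G x * ft g x * cnj (ft g x) \<partial>lborel)"
    unfolding eq[symmetric] by (rule integral_complex_of_real[symmetric])
  also have "\<dots> = (\<integral>x. (G x * ft g x) * (\<integral>\<xi>. cnj (g \<xi>) * cis (- (x \<bullet> \<xi>)) \<partial>lborel) \<partial>lborel)"
    unfolding cnj_ft by simp
  also have "\<dots> = (\<integral>\<xi>. cnj (g \<xi>) * (\<integral>x. G x * ft g x * cis (- (x \<bullet> \<xi>)) \<partial>lborel) \<partial>lborel)"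
    by (rule integral_kernel_swap[OF Gf cg]) auto
  also have "\<dots> = (\<integral>\<xi>. cnj (g \<xi>) * (complex_of_real c * mollify s g \<xi>) \<partial>lborel)"
    using ft_gauss_ft[OF g s] unfolding c_def[symmetric] G_def[symmetric]
    by (simp add: ft_def[of "\<lambda>x. G x * ft g x"] inner_commute)
  finally have *: "complex_of_real (\<integral>x. gauss (s *\<^sub>R x) * (norm (ft g x))\<^sup>2 \<partial>lborel)
    = (\<integral>\<xi>. cnj (g \<xi>) * (complex_of_real c * mollify s g \<xi>) \<partial>lborel)" .
  have nonneg: "0 \<le> (\<integral>x. gauss (s *\<^sub>R x) * (norm (ft g x))\<^sup>2 \<partial>lborel)"
    by (intro integral_nonneg_AE AE_I2) (simp add: gauss_nonneg)
  have "(\<integral>\<^sup>+x. ennreal (gauss (s *\<^sub>R x) * (norm (ft g x))\<^sup>2) \<partial>lborel)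
      = ennreal (\<integral>x. gauss (s *\<^sub>R x) * (norm (ft g x))\<^sup>2 \<partial>lborel)"
    by (rule nn_integral_eq_integral[OF int]) (simp add: gauss_nonneg)
  also have "\<dots> = ennreal (norm (\<integral>\<xi>. cnj (g \<xi>) * (complex_of_real c * mollify s g \<xi>) \<partial>lborel))"
    using nonneg unfolding *[symmetric] by simp
  also have "\<dots> \<le> (\<integral>\<^sup>+\<xi>. ennreal (norm (cnj (g \<xi>) * (complex_of_real c * mollify s g \<xi>))) \<partial>lborel)"
    by (rule ennreal_norm_integral_le)
  also have "\<dots> = (\<integral>\<^sup>+\<xi>. ennreal c * (ennreal (norm (g \<xi>)) * ennreal (norm (mollify s g \<xi>))) \<partial>lborel)"
    by (intro nn_integral_cong) (simp add: norm_mult c ennreal_mult'' mult_ac)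
  also have "\<dots> = ennreal c * (\<integral>\<^sup>+\<xi>. ennreal (norm (g \<xi>)) * ennreal (norm (mollify s g \<xi>)) \<partial>lborel)"
    by (rule nn_integral_cmult) measurable
  also have "(\<integral>\<^sup>+\<xi>. ennreal (norm (g \<xi>)) * ennreal (norm (mollify s g \<xi>)) \<partial>lborel)
     \<le> (\<integral>\<^sup>+\<xi>. ennreal (norm (g \<xi>)) * (\<integral>\<^sup>+z. ennreal (norm (g (\<xi> + s *\<^sub>R z) * complex_of_real (gauss z))) \<partial>lborel) \<partial>lborel)"
    unfolding mollify_def by (intro nn_integral_mono mult_left_mono ennreal_norm_integral_le) simp
  also have "\<dots> = (\<integral>\<^sup>+\<xi>. \<integral>\<^sup>+z. ennreal (norm (g \<xi>)) * ennreal (norm (g (\<xi> + s *\<^sub>R z) * complex_of_real (gauss z))) \<partial>lborel \<partial>lborel)"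
    by (intro nn_integral_cong nn_integral_cmult[symmetric]) measurable
  also have "\<dots> = (\<integral>\<^sup>+z. \<integral>\<^sup>+\<xi>. ennreal (norm (g \<xi>)) * ennreal (norm (g (\<xi> + s *\<^sub>R z) * complex_of_real (gauss z))) \<partial>lborel \<partial>lborel)"
    by (rule lborel_pair.Fubini') measurable
  also have "\<dots> \<le> (\<integral>\<^sup>+z. \<integral>\<^sup>+\<xi>. ennreal (gauss z) *
      (ennreal ((norm (g \<xi>))\<^sup>2 / 2) + ennreal ((norm (g (\<xi> + s *\<^sub>R z)))\<^sup>2 / 2)) \<partial>lborel \<partial>lborel)"
  \<comment> \<open>AM-GM separates the two values of \<open>g\<close>. For fixed \<open>z\<close>
    translation invariance then turns each summand into half of the squared L^2 norm, even when that
    norm is infinite.\<close>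
  proof (intro nn_integral_mono)
    fix z \<xi> :: 'a
    have "norm (g \<xi>) * norm (g (\<xi> + s *\<^sub>R z)) \<le> (norm (g \<xi>))\<^sup>2 / 2 + (norm (g (\<xi> + s *\<^sub>R z)))\<^sup>2 / 2"
      using sum_squares_bound[of "norm (g \<xi>)" "norm (g (\<xi> + s *\<^sub>R z))"] by simp
    then have "gauss z * (norm (g \<xi>) * norm (g (\<xi> + s *\<^sub>R z))) \<le>
        gauss z * ((norm (g \<xi>))\<^sup>2 / 2 + (norm (g (\<xi> + s *\<^sub>R z)))\<^sup>2 / 2)"
      by (intro mult_left_mono gauss_nonneg)
    then have "ennreal (gauss z * (norm (g \<xi>) * norm (g (\<xi> + s *\<^sub>R z)))) \<le>
        ennreal (gauss z * ((norm (g \<xi>))\<^sup>2 / 2 + (norm (g (\<xi> + s *\<^sub>R z)))\<^sup>2 / 2))"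
      by (rule ennreal_leI)
    then show "ennreal (norm (g \<xi>)) * ennreal (norm (g (\<xi> + s *\<^sub>R z) * complex_of_real (gauss z))) \<le>
      ennreal (gauss z) * (ennreal ((norm (g \<xi>))\<^sup>2 / 2) + ennreal ((norm (g (\<xi> + s *\<^sub>R z)))\<^sup>2 / 2))"
      by (simp add: norm_mult gauss_nonneg ennreal_mult'' ennreal_mult' mult_ac flip: ennreal_plus)
  qed
  also have "\<dots> = (\<integral>\<^sup>+z. ennreal (gauss z) * (\<integral>\<^sup>+\<xi>. ennreal ((norm (g \<xi>))\<^sup>2) \<partial>lborel) \<partial>(lborel :: 'a measure))"
  proof (rule nn_integral_cong)
    fix z :: 'a
    have "(\<integral>\<^sup>+\<xi>. ennreal (gauss z) * (ennreal ((norm (g \<xi>))\<^sup>2 / 2) + ennreal ((norm (g (\<xi> + s *\<^sub>R z)))\<^sup>2 / 2)) \<partial>lborel)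
       = ennreal (gauss z) * ((\<integral>\<^sup>+\<xi>. ennreal ((norm (g \<xi>))\<^sup>2 / 2) \<partial>lborel) + (\<integral>\<^sup>+\<xi>. ennreal ((norm (g (\<xi> + s *\<^sub>R z)))\<^sup>2 / 2) \<partial>lborel))"
      by (subst nn_integral_cmult) (auto simp: nn_integral_add)
    also have "(\<integral>\<^sup>+\<xi>. ennreal ((norm (g (\<xi> + s *\<^sub>R z)))\<^sup>2 / 2) \<partial>lborel) = (\<integral>\<^sup>+\<xi>. ennreal ((norm (g \<xi>))\<^sup>2 / 2) \<partial>lborel)"
      by (rule nn_integral_lborel_translate[of "\<lambda>\<xi>. ennreal ((norm (g \<xi>))\<^sup>2 / 2)"]) measurable
    also have "(\<integral>\<^sup>+\<xi>. ennreal ((norm (g \<xi>))\<^sup>2 / 2) \<partial>lborel) + (\<integral>\<^sup>+\<xi>. ennreal ((norm (g \<xi>))\<^sup>2 / 2) \<partial>lborel)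
        = (\<integral>\<^sup>+\<xi>. ennreal ((norm (g \<xi>))\<^sup>2) \<partial>lborel)"
      by (subst nn_integral_add[symmetric]) (auto simp flip: ennreal_plus)
    finally show "(\<integral>\<^sup>+\<xi>. ennreal (gauss z) * (ennreal ((norm (g \<xi>))\<^sup>2 / 2) + ennreal ((norm (g (\<xi> + s *\<^sub>R z)))\<^sup>2 / 2)) \<partial>lborel)
       = ennreal (gauss z) * (\<integral>\<^sup>+\<xi>. ennreal ((norm (g \<xi>))\<^sup>2) \<partial>lborel)" .
  qed
  also have "\<dots> = (\<integral>\<^sup>+\<xi>. ennreal ((norm (g \<xi>))\<^sup>2) \<partial>lborel)"
    by (subst nn_integral_multc) (auto simp: nn_integral_gauss)
  finally show ?thesis unfolding c_def by (simp add: mult_left_mono)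
qed

lemma plancherel_upper:
  fixes g :: "'a::euclidean_space \<Rightarrow> complex"
  assumes g: "integrable lborel g"
  shows "(\<integral>\<^sup>+x. ennreal ((norm (ft g x))\<^sup>2) \<partial>lborel)
     \<le> ennreal ((2 * pi) ^ DIM('a)) * (\<integral>\<^sup>+\<xi>. ennreal ((norm (g \<xi>))\<^sup>2) \<partial>lborel)"
proof -
  have [measurable]: "g \<in> borel_measurable borel" using borel_measurable_integrable[OF g] by simp
  define c where "c = sqrt (2 * pi) ^ DIM('a)"
  have c: "c > 0" by (simp add: c_def)
  have cc: "c * c = (2 * pi) ^ DIM('a)"
    unfolding c_def power_mult_distrib[symmetric] by simp
  define s where "s n = 1 / real (Suc n)" for n
  have s: "s \<longlonglongrightarrow> 0" "s n > 0" for n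
    using LIMSEQ_inverse_real_of_nat by (auto simp: s_def[abs_def] inverse_eq_divide)
  show ?thesis
  proof (rule nn_integral_fatou_bound)
    \<comment> \<open>The factor \<open>c\<close> normalises the Gaussian to the value 1 at the
      origin, so that the damping disappears in the limit. It contributes the second power of
      \<open>c\<close> to the constant.\<close>
    show "(\<lambda>x. ennreal (c * (gauss (s n *\<^sub>R x) * (norm (ft g x))\<^sup>2))) \<in> borel_measurable lborel" for n
      by measurable
    show "AE x in lborel. (\<lambda>n. ennreal (c * (gauss (s n *\<^sub>R x) * (norm (ft g x))\<^sup>2))) \<longlonglongrightarrow> ennreal ((norm (ft g x))\<^sup>2)"
    proof (intro AE_I2 tendsto_ennrealI)
      fix x
      have "(\<lambda>n. exp (- (norm (s n *\<^sub>R x))\<^sup>2 / 2) * (norm (ft g x))\<^sup>2) \<longlonglongrightarrow> exp (- (norm (0 *\<^sub>R x))\<^sup>2 / 2) * (norm (ft g x))\<^sup>2"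
        by (intro tendsto_intros s) simp
      then show "(\<lambda>n. c * (gauss (s n *\<^sub>R x) * (norm (ft g x))\<^sup>2)) \<longlonglongrightarrow> (norm (ft g x))\<^sup>2"
        using c unfolding gauss_eq c_def[symmetric] by simp
    qed
    fix n
    have "(\<integral>\<^sup>+x. ennreal (c * (gauss (s n *\<^sub>R x) * (norm (ft g x))\<^sup>2)) \<partial>lborel)
        = ennreal c * (\<integral>\<^sup>+x. ennreal (gauss (s n *\<^sub>R x) * (norm (ft g x))\<^sup>2) \<partial>lborel)"
      using c by (subst nn_integral_cmult[symmetric]) (auto simp: ennreal_mult')
    also have "\<dots> \<le> ennreal c * (ennreal c * (\<integral>\<^sup>+\<xi>. ennreal ((norm (g \<xi>))\<^sup>2) \<partial>lborel))"
      unfolding c_def by (intro mult_left_mono plancherel_upper_gauss[OF g s(2)]) simp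
    also have "\<dots> = ennreal ((2 * pi) ^ DIM('a)) * (\<integral>\<^sup>+\<xi>. ennreal ((norm (g \<xi>))\<^sup>2) \<partial>lborel)"
      using c unfolding cc[symmetric] by (simp add: ennreal_mult' mult.assoc)
    finally show "(\<integral>\<^sup>+x. ennreal (c * (gauss (s n *\<^sub>R x) * (norm (ft g x))\<^sup>2)) \<partial>lborel) \<le> \<dots>" .
  qed
qed

text \<open>As the Gaussian has mass 1, \<open>mollify s g - g\<close> is a Gaussian average of
  translation differences, and Tonelli exchanges the average with the L^1 norm.\<close>

lemma mollify_L1:
  fixes g :: "'a::euclidean_space \<Rightarrow> complex"
  assumes g: "integrable lborel g" and s: "s > 0"
  shows "(\<integral>\<^sup>+\<xi>. ennreal (norm (mollify s g \<xi> - g \<xi>)) \<partial>lborel)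
     \<le> (\<integral>\<^sup>+z. ennreal (gauss z * translation_modulus g (s *\<^sub>R z)) \<partial>lborel)"
proof -
  have [measurable]: "g \<in> borel_measurable borel" using borel_measurable_integrable[OF g] by simp
  have "mollify s g \<xi> - g \<xi> = (\<integral>z. (g (\<xi> + s *\<^sub>R z) - g \<xi>) * complex_of_real (gauss z) \<partial>lborel)" for \<xi>
  proof -
    have 1: "integrable lborel (\<lambda>z. g (\<xi> + s *\<^sub>R z) * complex_of_real (gauss z))"
      by (rule Bochner_Integration.integrable_bound[OF integrable_lborel_affine[OF g, of s \<xi>]])
         (use s in \<open>auto simp: norm_mult gauss_nonneg mult_left_le gauss_le_1\<close>)
    have 2: "integrable lborel (\<lambda>z::'a. g \<xi> * complex_of_real (gauss z))"
      by (intro integrable_mult_right integrable_bounded_linear[OF bounded_linear_of_real integrable_gauss])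
    have "(\<integral>z. (g (\<xi> + s *\<^sub>R z) - g \<xi>) * complex_of_real (gauss z) \<partial>lborel)
      = (\<integral>z. g (\<xi> + s *\<^sub>R z) * complex_of_real (gauss z) - g \<xi> * complex_of_real (gauss z) \<partial>lborel)"
      by (simp add: left_diff_distrib)
    also have "\<dots> = mollify s g \<xi> - g \<xi>"
      by (subst Bochner_Integration.integral_diff[OF 1 2]) (simp add: mollify_def integral_gauss)
    finally show ?thesis by simp
  qed
  then have "(\<integral>\<^sup>+\<xi>. ennreal (norm (mollify s g \<xi> - g \<xi>)) \<partial>lborel) \<le>
      (\<integral>\<^sup>+\<xi>. \<integral>\<^sup>+z. ennreal (norm ((g (\<xi> + s *\<^sub>R z) - g \<xi>) * complex_of_real (gauss z))) \<partial>lborel \<partial>lborel)"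
    by (auto intro!: nn_integral_mono ennreal_norm_integral_le)
  also have "\<dots> = (\<integral>\<^sup>+z. \<integral>\<^sup>+\<xi>. ennreal (norm ((g (\<xi> + s *\<^sub>R z) - g \<xi>) * complex_of_real (gauss z))) \<partial>lborel \<partial>lborel)"
    by (rule lborel_pair.Fubini') measurable
  also have "\<dots> = (\<integral>\<^sup>+z. ennreal (gauss z * translation_modulus g (s *\<^sub>R z)) \<partial>lborel)"
  proof (intro nn_integral_cong)
    fix z :: 'a
    have "integrable lborel (\<lambda>\<xi>. norm (g (\<xi> + s *\<^sub>R z) - g \<xi>))"
      using g integrable_lborel_translate[OF g] by simp
    then have "(\<integral>\<^sup>+\<xi>. ennreal (norm (g (\<xi> + s *\<^sub>R z) - g \<xi>)) \<partial>lborel) = ennreal (translation_modulus g (s *\<^sub>R z))"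
      unfolding translation_modulus_def by (rule nn_integral_eq_integral) simp
    moreover have "(\<integral>\<^sup>+\<xi>. ennreal (norm ((g (\<xi> + s *\<^sub>R z) - g \<xi>) * complex_of_real (gauss z))) \<partial>lborel)
        = ennreal (gauss z) * (\<integral>\<^sup>+\<xi>. ennreal (norm (g (\<xi> + s *\<^sub>R z) - g \<xi>)) \<partial>lborel)"
      by (subst nn_integral_cmult[symmetric])
         (auto simp: norm_mult gauss_nonneg ennreal_mult'' mult.commute)
    ultimately show "(\<integral>\<^sup>+\<xi>. ennreal (norm ((g (\<xi> + s *\<^sub>R z) - g \<xi>) * complex_of_real (gauss z))) \<partial>lborel)
        = ennreal (gauss z * translation_modulus g (s *\<^sub>R z))"
      by (simp add: ennreal_mult' gauss_nonneg)
  qed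
  finally show ?thesis .
qed

lemma translation_modulus_measurable[measurable]:
  assumes [measurable]: "g \<in> borel_measurable borel"
  shows "translation_modulus g \<in> borel_measurable borel"
proof -
  have "(\<lambda>h. \<integral>x. norm (g (x + h) - g x) \<partial>lborel) \<in> borel_measurable borel" by measurable
  then show ?thesis by (simp add: translation_modulus_def[abs_def])
qed

text \<open>The upper bound is applied on the transform side, where the damped \<open>ft g\<close>
  is integrable although \<open>ft g\<close> itself need not be. Its transform is a multiple of a
  mollification of \<open>g\<close>, which tends to \<open>g\<close> in L^1.\<close>

lemma plancherel_lower:
  fixes g :: "'a::euclidean_space \<Rightarrow> complex"
  assumes g: "integrable lborel g"
  shows "ennreal ((2 * pi) ^ DIM('a)) * (\<integral>\<^sup>+\<xi>. ennreal ((norm (g \<xi>))\<^sup>2) \<partial>lborel)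
     \<le> (\<integral>\<^sup>+x. ennreal ((norm (ft g x))\<^sup>2) \<partial>lborel)"
proof -
  have [measurable]: "g \<in> borel_measurable borel" using borel_measurable_integrable[OF g] by simp
  define c where "c = sqrt (2 * pi) ^ DIM('a)"
  have c: "c > 0" by (simp add: c_def)
  have cc: "c\<^sup>2 = (2 * pi) ^ DIM('a)"
    unfolding c_def power2_eq_square power_mult_distrib[symmetric] by simp
  define s where "s n = 1 / real (Suc n)" for n
  have s: "s \<longlonglongrightarrow> 0" "s n > 0" for n
    using LIMSEQ_inverse_real_of_nat by (auto simp: s_def[abs_def] inverse_eq_divide)
  define b where "b n = (\<integral>z. gauss z * translation_modulus g (s n *\<^sub>R z) \<partial>lborel)" for n
  \<comment> \<open>Comparison with the zero function bounds the modulus by twice the L^1 norm,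
    uniformly in the shift; this is the majorant for \<open>b\<close>.\<close>
  define B where "B = 2 * (\<integral>x. norm (g x) \<partial>lborel)"
  have tm_le: "translation_modulus g h \<le> B" for h
    using translation_modulus_perturb[OF g, of "\<lambda>_. 0" h] unfolding B_def
    by (simp add: translation_modulus_def[of "\<lambda>_. 0"])
  have GB: "integrable lborel (\<lambda>z::'a. gauss z * B)" by (intro integrable_mult_left integrable_gauss)
  have tm_le': "norm (gauss z * translation_modulus g h) \<le> gauss z * B" for z :: 'a and h
    by (simp add: abs_mult gauss_nonneg translation_modulus_nonneg tm_le mult_left_mono)
  have int_b: "integrable lborel (\<lambda>z. gauss z * translation_modulus g (s n *\<^sub>R z))" for n
  proof (rule Bochner_Integration.integrable_bound[OF GB])
    show "AE z in lborel. norm (gauss z * translation_modulus g (s n *\<^sub>R z)) \<le> norm (gauss z * B)"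
      using tm_le' abs_ge_self order_trans unfolding real_norm_def by (intro AE_I2) blast
  qed measurable
  have "b \<longlonglongrightarrow> integral\<^sup>L lborel (\<lambda>z::'a. 0)"
    unfolding b_def
  proof (rule integral_dominated_convergence[OF _ _ GB])
    show "AE z in lborel. (\<lambda>n. gauss z * translation_modulus g (s n *\<^sub>R z)) \<longlonglongrightarrow> 0"
    proof (rule AE_I2)
      fix z :: 'a
      have "(\<lambda>n. s n *\<^sub>R z) \<longlonglongrightarrow> 0 *\<^sub>R z" by (intro tendsto_intros s)
      then have "(\<lambda>n. translation_modulus g (s n *\<^sub>R z)) \<longlonglongrightarrow> 0"
        by (intro translation_modulus_tendsto[OF g]) simp
      from tendsto_mult[OF tendsto_const this, of "gauss z"]
      show "(\<lambda>n. gauss z * translation_modulus g (s n *\<^sub>R z)) \<longlonglongrightarrow> 0" by simp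
    qed
    show "AE z in lborel. norm (gauss z * translation_modulus g (s n *\<^sub>R z)) \<le> gauss z * B" for n
      using tm_le' by simp
  qed measurable
  then have b: "b \<longlonglongrightarrow> 0" by simp
  have L1: "(\<integral>\<^sup>+\<xi>. ennreal (norm (mollify (s n) g \<xi> - g \<xi>)) \<partial>lborel) \<le> ennreal (b n)" for n
  proof -
    have "(\<integral>\<^sup>+z. ennreal (gauss z * translation_modulus g (s n *\<^sub>R z)) \<partial>lborel) = ennreal (b n)"
      unfolding b_def by (rule nn_integral_eq_integral[OF int_b])
        (simp add: gauss_nonneg translation_modulus_nonneg)
    then show ?thesis using mollify_L1[OF g s(2), of n] by simp
  qed
  have int_m: "integrable lborel (\<lambda>\<xi>. mollify (s n) g \<xi> - g \<xi>)" for n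
    unfolding integrable_iff_bounded using L1[of n] by (auto simp: le_less_trans less_top[symmetric] top_unique)
  have b0: "b n \<ge> 0" for n
    unfolding b_def by (intro integral_nonneg_AE AE_I2) (simp add: gauss_nonneg translation_modulus_nonneg)
  have "(\<lambda>n. \<integral>\<xi>. norm (mollify (s n) g \<xi> - g \<xi>) \<partial>lborel) \<longlonglongrightarrow> 0"
  proof (rule Lim_null_comparison[OF always_eventually b], intro allI)
    fix n
    have "ennreal (\<integral>\<xi>. norm (mollify (s n) g \<xi> - g \<xi>) \<partial>lborel) \<le> ennreal (b n)"
      using L1[of n] by (subst (asm) nn_integral_eq_integral) (use int_m in auto)
    then show "norm (\<integral>\<xi>. norm (mollify (s n) g \<xi> - g \<xi>) \<partial>lborel) \<le> b n"
      using b0[of n] by simp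
  qed
  \<comment> \<open>Fatou's lemma requires convergence almost everywhere, which L^1 convergence
    provides along a subsequence.\<close>
  from tendsto_L1_AE_subseq[OF int_m this] obtain r where r: "strict_mono r"
    "AE \<xi> in lborel. (\<lambda>n. mollify (s (r n)) g \<xi> - g \<xi>) \<longlonglongrightarrow> 0" by auto
  show ?thesis
  proof (subst nn_integral_cmult[symmetric], measurable, rule nn_integral_fatou_bound)
    show "(\<lambda>\<xi>. ennreal (c\<^sup>2 * (norm (mollify (s (r n)) g \<xi>))\<^sup>2)) \<in> borel_measurable lborel" for n
      by measurable
    show "AE \<xi> in lborel. (\<lambda>n. ennreal (c\<^sup>2 * (norm (mollify (s (r n)) g \<xi>))\<^sup>2))
       \<longlonglongrightarrow> ennreal ((2 * pi) ^ DIM('a)) * ennreal ((norm (g \<xi>))\<^sup>2)"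
      using r(2)
    proof eventually_elim
      case (elim \<xi>)
      then have "(\<lambda>n. mollify (s (r n)) g \<xi>) \<longlonglongrightarrow> g \<xi>" by (simp add: LIM_zero_iff)
      then have "(\<lambda>n. ennreal (c\<^sup>2 * (norm (mollify (s (r n)) g \<xi>))\<^sup>2)) \<longlonglongrightarrow> ennreal (c\<^sup>2 * (norm (g \<xi>))\<^sup>2)"
        by (intro tendsto_ennrealI tendsto_intros)
      then show ?case unfolding cc[symmetric] by (simp add: ennreal_mult')
    qed
    fix n
    define s' where "s' = s (r n)"
    have s': "s' > 0" using s(2) by (simp add: s'_def)
    define w where "w x = complex_of_real (gauss (s' *\<^sub>R x)) * ft g x" for x
    have w: "integrable lborel w" unfolding w_def using integrable_gauss_ft[OF g] s' by simp
    have [measurable]: "w \<in> borel_measurable borel" using borel_measurable_integrable[OF w] by simp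
    have "c\<^sup>2 * (norm (mollify s' g \<xi>))\<^sup>2 = (norm (ft w (- \<xi>)))\<^sup>2" for \<xi>
      using ft_gauss_ft[OF g s', of \<xi>] c unfolding w_def[abs_def] c_def[symmetric]
      by (simp add: norm_mult power_mult_distrib)
    then have "(\<integral>\<^sup>+\<xi>. ennreal (c\<^sup>2 * (norm (mollify s' g \<xi>))\<^sup>2) \<partial>lborel) = (\<integral>\<^sup>+\<xi>. ennreal ((norm (ft w (- \<xi>)))\<^sup>2) \<partial>lborel)"
      by simp
    also have "\<dots> = (\<integral>\<^sup>+\<xi>. ennreal ((norm (ft w \<xi>))\<^sup>2) \<partial>lborel)"
      by (rule nn_integral_lborel_uminus[of "\<lambda>\<xi>. ennreal ((norm (ft w \<xi>))\<^sup>2)"]) measurable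
    also have "\<dots> \<le> ennreal ((2 * pi) ^ DIM('a)) * (\<integral>\<^sup>+\<xi>. ennreal ((norm (w \<xi>))\<^sup>2) \<partial>lborel)"
      by (rule plancherel_upper[OF w])
    also have "\<dots> = (\<integral>\<^sup>+x. ennreal (c\<^sup>2) * ennreal ((norm (w x))\<^sup>2) \<partial>lborel)"
      by (simp add: cc nn_integral_cmult)
    also have "\<dots> \<le> (\<integral>\<^sup>+x. ennreal ((norm (ft g x))\<^sup>2) \<partial>lborel)"
    proof (rule nn_integral_mono)
      fix x :: 'a
      \<comment> \<open>The maximum of the Gaussian is \<open>1 / c\<close>, so damping absorbs
        exactly the constant that \<open>plancherel_upper\<close> introduces.\<close>
      have "c * gauss (s' *\<^sub>R x) \<le> 1" using c unfolding gauss_eq c_def[symmetric] by simp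
      then have "(c * gauss (s' *\<^sub>R x)) * norm (ft g x) \<le> 1 * norm (ft g x)"
        by (rule mult_right_mono) simp
      then have "(c * norm (w x))\<^sup>2 \<le> (norm (ft g x))\<^sup>2"
        using c by (intro power_mono) (auto simp: w_def norm_mult gauss_nonneg mult.assoc)
      then show "ennreal (c\<^sup>2) * ennreal ((norm (w x))\<^sup>2) \<le> ennreal ((norm (ft g x))\<^sup>2)"
        by (simp add: power_mult_distrib ennreal_leI flip: ennreal_mult)
    qed
    finally show "(\<integral>\<^sup>+\<xi>. ennreal (c\<^sup>2 * (norm (mollify (s (r n)) g \<xi>))\<^sup>2) \<partial>lborel)
       \<le> (\<integral>\<^sup>+x. ennreal ((norm (ft g x))\<^sup>2) \<partial>lborel)" unfolding s'_def .
  qed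
qed

section \<open>Plancherel and uniqueness for the inverse transform\<close>

lemma inverse_fourier_eq_ft:
  "inverse_fourier g x = complex_of_real (1 / (2 * pi) ^ DIM('a)) * ft g (x::'a::euclidean_space)"
  unfolding inverse_fourier_def ft_def by (simp add: mult.commute)

lemma inverse_fourier_measurable[measurable]:
  assumes [measurable]: "g \<in> borel_measurable borel"
  shows "inverse_fourier g \<in> borel_measurable borel"
  unfolding inverse_fourier_eq_ft[abs_def] by measurable

text \<open>The normalising constant enters squared, and the bounds for \<open>ft\<close> give one
  power of it back.\<close>

theorem plancherel_L1:
  fixes g :: "'a::euclidean_space \<Rightarrow> complex"
  assumes g: "integrable lborel g"
  shows "(\<integral>\<^sup>+x. ennreal ((norm (inverse_fourier g x))\<^sup>2) \<partial>lborel)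
     = ennreal (1 / (2 * pi) ^ DIM('a)) * (\<integral>\<^sup>+\<xi>. ennreal ((norm (g \<xi>))\<^sup>2) \<partial>lborel)"
proof -
  have [measurable]: "g \<in> borel_measurable borel" using borel_measurable_integrable[OF g] by simp
  define c :: real where "c = (2 * pi) ^ DIM('a)"
  have c: "c > 0" by (simp add: c_def)
  have "(\<integral>\<^sup>+x. ennreal ((norm (inverse_fourier g x))\<^sup>2) \<partial>lborel)
      = (\<integral>\<^sup>+x. ennreal (1 / c\<^sup>2) * ennreal ((norm (ft g x))\<^sup>2) \<partial>lborel)"
    unfolding inverse_fourier_eq_ft c_def[symmetric] using c
    by (simp add: norm_mult norm_divide power_mult_distrib power_divide flip: ennreal_mult)
  also have "\<dots> = ennreal (1 / c\<^sup>2) * (\<integral>\<^sup>+x. ennreal ((norm (ft g x))\<^sup>2) \<partial>lborel)"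
    by (rule nn_integral_cmult) measurable
  also have "(\<integral>\<^sup>+x. ennreal ((norm (ft g x))\<^sup>2) \<partial>lborel) = ennreal c * (\<integral>\<^sup>+\<xi>. ennreal ((norm (g \<xi>))\<^sup>2) \<partial>lborel)"
    unfolding c_def using plancherel_upper[OF g] plancherel_lower[OF g] by (rule antisym)
  also have "ennreal (1 / c\<^sup>2) * (ennreal c * (\<integral>\<^sup>+\<xi>. ennreal ((norm (g \<xi>))\<^sup>2) \<partial>lborel))
     = ennreal (1 / c) * (\<integral>\<^sup>+\<xi>. ennreal ((norm (g \<xi>))\<^sup>2) \<partial>lborel)"
    using c by (simp add: mult.assoc[symmetric] ennreal_mult'[symmetric] power2_eq_square)
  finally show ?thesis unfolding c_def .
qed

text \<open>The difference of two transforms is in L^1 with vanishing inverse transform. Plancherel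
  in [0,\<infinity>] then forces its L^2 norm to be 0, without any prior knowledge that it is
  finite.\<close>

lemma has_fourier_transform_unique:
  fixes f :: "'a::euclidean_space \<Rightarrow> complex"
  assumes "has_fourier_transform f g" "has_fourier_transform f h"
  shows "AE \<xi> in lborel. g \<xi> = h \<xi>"
proof -
  have g: "integrable lborel g" and h: "integrable lborel h"
    and eq: "AE x in lborel. inverse_fourier g x = inverse_fourier h x"
    using assms unfolding has_fourier_transform_def by auto
  have [measurable]: "g \<in> borel_measurable borel" "h \<in> borel_measurable borel"
    using borel_measurable_integrable[OF g] borel_measurable_integrable[OF h] by auto
  have cis_int: "integrable lborel (\<lambda>\<xi>. cis (x \<bullet> \<xi>) * k \<xi>)" if "integrable lborel k" for k and x :: 'a
    by (rule Bochner_Integration.integrable_bound[OF that])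
       (use borel_measurable_integrable[OF that] in \<open>auto simp: norm_mult\<close>)
  define k where "k \<xi> = g \<xi> - h \<xi>" for \<xi>
  have k: "integrable lborel k" unfolding k_def using g h by simp
  have [measurable]: "k \<in> borel_measurable borel" using borel_measurable_integrable[OF k] by simp
  have "inverse_fourier k x = inverse_fourier g x - inverse_fourier h x" for x
    unfolding inverse_fourier_def k_def
    using cis_int[OF g, of x] cis_int[OF h, of x] by (simp add: right_diff_distrib)
  then have "(\<integral>\<^sup>+x. ennreal ((norm (inverse_fourier k x))\<^sup>2) \<partial>lborel) = integral\<^sup>N lborel (\<lambda>x::'a. 0)"
    using eq by (intro nn_integral_cong_AE) auto
  then have "(\<integral>\<^sup>+\<xi>. ennreal ((norm (k \<xi>))\<^sup>2) \<partial>lborel) = 0"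
    using plancherel_L1[OF k] by simp
  then have "AE \<xi> in lborel. ennreal ((norm (k \<xi>))\<^sup>2) = 0"
    by (subst (asm) nn_integral_0_iff_AE) auto
  then show ?thesis by eventually_elim (simp add: k_def)
qed

subsection \<open>Lebesgue measure on vectors\<close>

lemma Basis_vec_eq: "(Basis :: ('a::euclidean_space ^ 'n::finite) set) = (\<lambda>(i, b). axis i b) ` (UNIV \<times> Basis)"
  unfolding Basis_vec_def by (rule set_eqI, simp add: image_iff Bex_def split_paired_Ex, blast)

lemma prod_Basis_vec:
  "(\<Prod>b\<in>(Basis :: ('a::euclidean_space ^ 'n::finite) set). f b) = (\<Prod>i\<in>UNIV. \<Prod>b\<in>Basis. f (axis i b))"
proof -
  have "inj_on (\<lambda>(i::'n, b::'a). axis i b) (UNIV \<times> Basis)"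
  proof (rule inj_onI)
    fix p q :: "'n \<times> 'a"
    assume "p \<in> UNIV \<times> Basis" "q \<in> UNIV \<times> Basis" "(\<lambda>(i, b). axis i b) p = (\<lambda>(i, b). axis i b) q"
    then show "p = q"
      by (cases p; cases q) (auto simp: axis_eq_axis)
  qed
  then have "(\<Prod>b\<in>(Basis :: ('a ^ 'n) set). f b) = (\<Prod>p\<in>UNIV \<times> Basis. f (case p of (i, b) \<Rightarrow> axis i b))"
    unfolding Basis_vec_eq by (subst prod.reindex) (simp_all add: o_def)
  then show ?thesis
    by (simp add: prod.cartesian_product case_prod_beta)
qed

lemma mem_box_vec:
  "x \<in> box l u \<longleftrightarrow> (\<forall>i. x $ i \<in> box (l $ i) (u $ i))" for x :: "'a::euclidean_space ^ 'n::finite"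
  unfolding mem_box Basis_vec_eq by (auto simp: inner_axis)

lemma borel_measurable_vec_lambda[measurable (raw)]:
  fixes f :: "'n::finite \<Rightarrow> 'c \<Rightarrow> 'a::euclidean_space"
  assumes "\<And>i. f i \<in> borel_measurable M"
  shows "(\<lambda>x. \<chi> i. f i x) \<in> borel_measurable M"
  unfolding borel_measurable_euclidean_space[of "\<lambda>x. \<chi> i. f i x"] Basis_vec_eq
  using assms by (auto simp: inner_axis)

lemma borel_measurable_vec_nth_compose[measurable (raw)]:
  fixes f :: "'c \<Rightarrow> 'a::euclidean_space ^ 'n::finite"
  assumes "f \<in> borel_measurable M"
  shows "(\<lambda>x. f x $ i) \<in> borel_measurable M"
  by (rule measurable_compose[OF assms]) (intro borel_measurable_continuous_onI continuous_intros)

text \<open>Boxes in the vector space are products of boxes, and Lebesgue measure is determined by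
  its values on boxes. This gives access to Fubini over the entries.\<close>

lemma lborel_vec:
  "(lborel :: ('a::euclidean_space ^ 'n::finite) measure) = distr (\<Pi>\<^sub>M i\<in>UNIV. lborel) borel (\<lambda>f. \<chi> i. f i)"
proof (rule lborel_eqI)
  interpret product_sigma_finite "\<lambda>_::'n. lborel :: 'a measure" by standard
  fix l u :: "'a ^ 'n"
  assume le: "\<And>b. b \<in> Basis \<Longrightarrow> l \<bullet> b \<le> u \<bullet> b"
  have le': "l $ i \<bullet> b \<le> u $ i \<bullet> b" if "b \<in> Basis" for i b
    using le[of "axis i b"] that by (auto simp: inner_axis Basis_vec_def)
  have [measurable]: "(\<lambda>f. \<chi> i. f i) \<in> measurable (\<Pi>\<^sub>M i\<in>UNIV. lborel) (borel :: ('a ^ 'n) measure)"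
    by measurable
  have "(\<lambda>f. \<chi> i. f i) -` box l u \<inter> space (\<Pi>\<^sub>M i\<in>UNIV. (lborel :: 'a measure)) = (\<Pi>\<^sub>E i\<in>UNIV. box (l $ i) (u $ i))"
    by (auto simp: mem_box_vec space_PiM PiE_iff)
  then have "emeasure (distr (\<Pi>\<^sub>M i\<in>UNIV. lborel) borel (\<lambda>f. \<chi> i. f i)) (box l u)
      = emeasure (\<Pi>\<^sub>M i\<in>UNIV. lborel) (\<Pi>\<^sub>E i\<in>UNIV. box (l $ i) (u $ i))"
    by (subst emeasure_distr) auto
  also have "\<dots> = (\<Prod>i\<in>UNIV. emeasure lborel (box (l $ i) (u $ i)))"
    by (rule emeasure_PiM) auto
  also have "\<dots> = (\<Prod>i\<in>UNIV. ennreal (\<Prod>b\<in>Basis. (u $ i - l $ i) \<bullet> b))"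
    using le' by (simp add: emeasure_lborel_box)
  also have "\<dots> = ennreal (\<Prod>i\<in>UNIV. \<Prod>b\<in>Basis. (u $ i - l $ i) \<bullet> b)"
    using le' by (intro prod_ennreal prod_nonneg) (auto simp: inner_diff_left)
  also have "\<dots> = ennreal (\<Prod>b\<in>Basis. (u - l) \<bullet> b)"
    by (simp add: prod_Basis_vec inner_axis)
  finally show "emeasure (distr (\<Pi>\<^sub>M i\<in>UNIV. lborel) borel (\<lambda>f. \<chi> i. f i)) (box l u)
      = ennreal (\<Prod>b\<in>Basis. (u - l) \<bullet> b)" .
qed simp

lemma nn_integral_vec_prod:
  fixes h :: "'n::finite \<Rightarrow> 'a::euclidean_space \<Rightarrow> ennreal"
  assumes [measurable]: "\<And>i. h i \<in> borel_measurable borel"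
  shows "(\<integral>\<^sup>+x. (\<Prod>i\<in>UNIV. h i (x $ i)) \<partial>lborel) = (\<Prod>i\<in>UNIV. \<integral>\<^sup>+x. h i x \<partial>lborel)"
proof -
  interpret product_sigma_finite "\<lambda>_::'n. lborel :: 'a measure" by standard
  have [measurable]: "(\<lambda>f. \<chi> i. f i) \<in> measurable (\<Pi>\<^sub>M i\<in>UNIV. lborel) (borel :: ('a ^ 'n) measure)"
    by measurable
  show ?thesis
    unfolding lborel_vec by (subst nn_integral_distr) (auto simp: product_nn_integral_prod)
qed

lemma integral_vec_prod:
  fixes h :: "'n::finite \<Rightarrow> 'a::euclidean_space \<Rightarrow> 'b::{real_normed_field,banach,second_countable_topology}"
  assumes h: "\<And>i. integrable lborel (h i)"
  shows "integrable lborel (\<lambda>x. \<Prod>i\<in>UNIV. h i (x $ i))"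
    and "(\<integral>x. (\<Prod>i\<in>UNIV. h i (x $ i)) \<partial>lborel) = (\<Prod>i\<in>UNIV. \<integral>x. h i x \<partial>lborel)"
proof -
  interpret product_sigma_finite "\<lambda>_::'n. lborel :: 'a measure" by standard
  have [measurable]: "h i \<in> borel_measurable borel" for i
    using borel_measurable_integrable[OF h] by simp
  have [measurable]: "(\<lambda>f. \<chi> i. f i) \<in> measurable (\<Pi>\<^sub>M i\<in>UNIV. lborel) (borel :: ('a ^ 'n) measure)"
    by measurable
  show "integrable lborel (\<lambda>x. \<Prod>i\<in>UNIV. h i (x $ i))"
    unfolding lborel_vec by (subst integrable_distr_eq) (auto intro!: product_integrable_prod h)
  show "(\<integral>x. (\<Prod>i\<in>UNIV. h i (x $ i)) \<partial>lborel) = (\<Prod>i\<in>UNIV. \<integral>x. h i x \<partial>lborel)"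
    unfolding lborel_vec by (subst integral_distr) (auto intro!: product_integral_prod h)
qed

section \<open>Splitting off the last of the d+1 frequencies\<close>

definition vec_snoc :: "'a ^ 'n::finite \<Rightarrow> 'a \<Rightarrow> 'a ^ 'n option" where
  "vec_snoc y v = (\<chi> j. case j of None \<Rightarrow> v | Some i \<Rightarrow> y $ i)"

lemma vec_snoc_nth[simp]: "vec_snoc y v $ None = v" "vec_snoc y v $ Some i = y $ i"
  by (simp_all add: vec_snoc_def)

lemma all_option: "(\<forall>j. P j) \<longleftrightarrow> P None \<and> (\<forall>i. P (Some i))"
  by (metis option.exhaust)

lemma prod_UNIV_option: "(\<Prod>j\<in>UNIV. f j) = f None * (\<Prod>i\<in>UNIV. f (Some (i::'n::finite)))"
  by (simp add: UNIV_option_conv prod.reindex)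

lemma sum_UNIV_option: "(\<Sum>j\<in>UNIV. f j) = f None + (\<Sum>i\<in>UNIV. f (Some (i::'n::finite)))"
  by (simp add: UNIV_option_conv sum.reindex)

lemma vec_snoc_measurable[measurable (raw)]:
  fixes f :: "'c \<Rightarrow> 'a::euclidean_space ^ 'n::finite"
  assumes [measurable]: "f \<in> borel_measurable M" "g \<in> borel_measurable M"
  shows "(\<lambda>x. vec_snoc (f x) (g x)) \<in> borel_measurable M"
  unfolding vec_snoc_def
proof (rule borel_measurable_vec_lambda)
  fix j :: "'n option"
  show "(\<lambda>x. case j of None \<Rightarrow> g x | Some i \<Rightarrow> f x $ i) \<in> borel_measurable M"
    by (cases j) auto
qed

lemma lborel_vec_snoc:
  "(lborel :: ('a::euclidean_space ^ 'n::finite option) measure) = distr lborel borel (\<lambda>(y, v). vec_snoc y v)"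
proof (rule lborel_eqI)
  fix l u :: "'a ^ 'n option"
  assume le: "\<And>b. b \<in> Basis \<Longrightarrow> l \<bullet> b \<le> u \<bullet> b"
  have le': "l $ i \<bullet> b \<le> u $ i \<bullet> b" if "b \<in> Basis" for i b
    using le[of "axis i b"] that by (auto simp: inner_axis Basis_vec_def)
  define l' u' :: "'a ^ 'n" where "l' = (\<chi> i. l $ Some i)" and "u' = (\<chi> i. u $ Some i)"
  have m: "(\<lambda>(y, v). vec_snoc y v) \<in> measurable lborel (borel :: ('a ^ 'n option) measure)"
    unfolding case_prod_beta lborel_prod[symmetric] by measurable
  have pre: "(\<lambda>(y, v). vec_snoc y v) -` box l u = box l' u' \<times> box (l $ None) (u $ None)"
    by (auto simp: mem_box_vec[where 'n="'n option"] mem_box_vec[where 'n='n] all_option l'_def u'_def)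
  have "emeasure (distr lborel borel (\<lambda>(y, v). vec_snoc y v)) (box l u)
     = emeasure (lborel \<Otimes>\<^sub>M lborel) (box l' u' \<times> box (l $ None) (u $ None))"
    using m by (subst emeasure_distr) (auto simp: pre lborel_prod)
  also have "\<dots> = emeasure lborel (box l' u') * emeasure lborel (box (l $ None) (u $ None))"
    by (rule lborel.emeasure_pair_measure_Times) auto
  also have "\<dots> = ennreal (\<Prod>b\<in>Basis. (u' - l') \<bullet> b) * ennreal (\<Prod>b\<in>Basis. (u $ None - l $ None) \<bullet> b)"
    using le' by (subst (1 2) emeasure_lborel_box) (auto simp: l'_def u'_def inner_axis Basis_vec_eq)
  also have "\<dots> = ennreal (\<Prod>b\<in>Basis. (u - l) \<bullet> b)"
    using le' by (subst ennreal_mult[symmetric])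
      (auto simp: prod_Basis_vec prod_UNIV_option inner_axis l'_def u'_def inner_diff_left mult.commute intro!: prod_nonneg)
  finally show "emeasure (distr lborel borel (\<lambda>(y, v). vec_snoc y v)) (box l u) = ennreal (\<Prod>b\<in>Basis. (u - l) \<bullet> b)" .
qed simp

text \<open>Recovers the frequencies from their differences: \<open>y\<close> is the vector of the
  eta_i of the overview and \<open>v\<close> is xi_(d+1).\<close>

definition shear_snoc :: "('a::ab_group_add ^ 'n::finite) \<times> 'a \<Rightarrow> 'a ^ 'n option" where
  "shear_snoc = (\<lambda>(y, v). vec_snoc (y + (\<chi> i. v)) v)"

lemma shear_snoc_measurable[measurable]:
  "(shear_snoc :: ('a::euclidean_space ^ 'n::finite) \<times> 'a \<Rightarrow> _) \<in> borel_measurable borel"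
  unfolding shear_snoc_def case_prod_beta borel_prod[symmetric] by measurable

text \<open>For fixed \<open>v\<close> the map only translates \<open>y\<close>, so it preserves
  measure by Tonelli.\<close>

lemma lborel_shear_snoc:
  "distr lborel borel shear_snoc = (lborel :: ('a::euclidean_space ^ 'n::finite option) measure)"
proof (rule measure_eqI)
  fix S :: "('a ^ 'n option) set" assume "S \<in> sets (distr lborel borel shear_snoc)"
  then have [measurable]: "S \<in> sets borel" by simp
  have [measurable]: "(\<lambda>(y, v). vec_snoc y v) \<in> measurable (borel \<Otimes>\<^sub>M borel) (borel :: ('a ^ 'n option) measure)"
    unfolding case_prod_beta by measurable
  have "emeasure (distr lborel borel shear_snoc) S = (\<integral>\<^sup>+\<xi>. indicator S \<xi> \<partial>distr lborel borel shear_snoc)"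
    by simp
  also have "\<dots> = (\<integral>\<^sup>+p. indicator S (shear_snoc p) \<partial>lborel)"
    by (rule nn_integral_distr) auto
  also have "\<dots> = (\<integral>\<^sup>+v. \<integral>\<^sup>+y. indicator S (vec_snoc (y + (\<chi> i. v)) v) \<partial>lborel \<partial>lborel)"
    unfolding lborel_prod[symmetric] shear_snoc_def
    by (subst lborel_pair.nn_integral_snd[symmetric]) (auto simp: case_prod_beta)
  also have "\<dots> = (\<integral>\<^sup>+v. \<integral>\<^sup>+y. indicator S (vec_snoc y v) \<partial>lborel \<partial>lborel)"
  proof (rule nn_integral_cong)
    fix v :: 'a
    show "(\<integral>\<^sup>+y. indicator S (vec_snoc (y + (\<chi> i. v)) v) \<partial>lborel) = (\<integral>\<^sup>+y. indicator S (vec_snoc y v) \<partial>lborel)"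
      by (rule nn_integral_lborel_translate[of "\<lambda>y. indicator S (vec_snoc y v)"]) measurable
  qed
  also have "\<dots> = (\<integral>\<^sup>+p. indicator S (vec_snoc (fst p) (snd p)) \<partial>(lborel \<Otimes>\<^sub>M lborel))"
    using lborel_pair.nn_integral_snd[of "\<lambda>p. indicator S (vec_snoc (fst p :: 'a ^ 'n) (snd p))"] by simp
  also have "\<dots> = (\<integral>\<^sup>+\<xi>. indicator S \<xi> \<partial>distr lborel borel (\<lambda>(y, v). vec_snoc y v))"
    unfolding lborel_prod by (subst nn_integral_distr) (auto simp: case_prod_beta borel_prod[symmetric])
  also have "\<dots> = emeasure lborel S"
    by (simp add: lborel_vec_snoc[symmetric])
  finally show "emeasure (distr lborel borel shear_snoc) S = emeasure lborel S" .
qed simp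

subsection \<open>Linear changes of variables and determinants\<close>

lemma det_measurable[measurable (raw)]:
  fixes f :: "'c \<Rightarrow> real ^ 'n::finite ^ 'n"
  assumes [measurable]: "f \<in> borel_measurable M"
  shows "(\<lambda>x. det (f x)) \<in> borel_measurable M"
  unfolding det_def by measurable

lemma matrix_vector_mult_measurable[measurable (raw)]:
  fixes f :: "'c \<Rightarrow> real ^ 'n::finite ^ 'm::finite"
  assumes [measurable]: "f \<in> borel_measurable M" "g \<in> borel_measurable M"
  shows "(\<lambda>x. f x *v g x) \<in> borel_measurable M"
  unfolding matrix_vector_mult_def by measurable

lemma lborel_permute_coordinates:
  assumes p: "\<And>i. p (p i) = i"
  shows "distr lborel borel (\<lambda>x. \<chi> i. x $ p i) = (lborel :: (real ^ 'n::finite) measure)"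
proof (rule lborel_eqI[symmetric])
  have bij: "bij p" using p by (rule involuntory_imp_bij)
  let ?T = "\<lambda>x::real ^ 'n. \<chi> i. x $ p i"
  fix l u :: "real ^ 'n" assume le: "\<And>b. b \<in> Basis \<Longrightarrow> l \<bullet> b \<le> u \<bullet> b"
  have le': "l $ i \<le> u $ i" for i
    using le[of "axis i 1"] by (auto simp: inner_axis Basis_vec_def)
  have pre: "?T -` box l u = box (?T l) (?T u)"
    by (auto simp: mem_box_cart) (metis p)+
  have "emeasure (distr lborel borel ?T) (box l u) = emeasure lborel (box (?T l) (?T u))"
    by (subst emeasure_distr) (auto simp: pre)
  also have "\<dots> = ennreal (\<Prod>b\<in>Basis. (?T u - ?T l) \<bullet> b)"
    using le' by (subst emeasure_lborel_box) (auto simp: inner_axis Basis_vec_def)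
  also have "(\<Prod>b\<in>Basis. (?T u - ?T l) \<bullet> b) = (\<Prod>i\<in>UNIV. u $ p i - l $ p i)"
    by (simp add: prod_Basis_vec inner_axis)
  also have "\<dots> = (\<Prod>i\<in>UNIV. u $ i - l $ i)"
    by (rule prod.reindex_bij_betw[OF bij, of "\<lambda>i. u $ i - l $ i"])
  also have "\<dots> = (\<Prod>b\<in>Basis. (u - l) \<bullet> b)"
    by (simp add: prod_Basis_vec inner_axis)
  finally show "emeasure (distr lborel borel ?T) (box l u) = ennreal (\<Prod>b\<in>Basis. (u - l) \<bullet> b)" .
qed simp

text \<open>With the other coordinates fixed, coordinate \<open>m\<close> is translated by
  \<open>c * x $ n\<close>, which is constant because \<open>m\<close> and \<open>n\<close>
  differ.\<close>

lemma nn_integral_lborel_shear: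
  fixes k :: "real ^ 'n::finite \<Rightarrow> ennreal"
  assumes [measurable]: "k \<in> borel_measurable borel" and mn: "m \<noteq> n"
  shows "(\<integral>\<^sup>+x. k (\<chi> i. if i = m then x $ m + c * x $ n else x $ i) \<partial>lborel) = (\<integral>\<^sup>+x. k x \<partial>lborel)"
proof -
  interpret product_sigma_finite "\<lambda>_::'n. lborel :: real measure" by standard
  define I where "I = UNIV - {m}"
  have I: "finite I" "m \<notin> I" "insert m I = UNIV" by (auto simp: I_def)
  have [measurable]: "(\<lambda>f. \<chi> i. f i) \<in> measurable (\<Pi>\<^sub>M i\<in>UNIV. lborel) (borel :: (real ^ 'n) measure)"
    by measurable
  let ?T = "\<lambda>x::real ^ 'n. \<chi> i. if i = m then x $ m + c * x $ n else x $ i"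
  have T[measurable]: "?T \<in> measurable borel borel"
  proof (rule borel_measurable_vec_lambda)
    fix i show "(\<lambda>x. if i = m then x $ m + c * x $ n else x $ i) \<in> borel_measurable borel"
      by (cases "i = m") auto
  qed
  have split: "(\<integral>\<^sup>+x. q x \<partial>lborel) = (\<integral>\<^sup>+f. \<integral>\<^sup>+y. q (\<chi> i. (f(m := y)) i) \<partial>lborel \<partial>\<Pi>\<^sub>M i\<in>I. lborel)"
    if [measurable]: "q \<in> borel_measurable borel" for q :: "real ^ 'n \<Rightarrow> ennreal"
  proof -
    have "(\<integral>\<^sup>+x. q x \<partial>lborel) = (\<integral>\<^sup>+f. q (\<chi> i. f i) \<partial>\<Pi>\<^sub>M i\<in>UNIV. lborel)"
      unfolding lborel_vec by (rule nn_integral_distr) measurable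
    also have "\<dots> = (\<integral>\<^sup>+f. q (\<chi> i. f i) \<partial>\<Pi>\<^sub>M i\<in>insert m I. lborel)"
      by (simp add: I)
    also have "\<dots> = (\<integral>\<^sup>+f. \<integral>\<^sup>+y. q (\<chi> i. (f(m := y)) i) \<partial>lborel \<partial>\<Pi>\<^sub>M i\<in>I. lborel)"
      by (rule product_nn_integral_insert[OF I(1,2)]) (simp add: I)
    finally show ?thesis .
  qed
  have "(\<integral>\<^sup>+x. k (?T x) \<partial>lborel) = (\<integral>\<^sup>+f. \<integral>\<^sup>+y. k (?T (\<chi> i. (f(m := y)) i)) \<partial>lborel \<partial>\<Pi>\<^sub>M i\<in>I. lborel)"
    by (rule split) measurable
  also have "\<dots> = (\<integral>\<^sup>+f. \<integral>\<^sup>+y. k (\<chi> i. (f(m := y)) i) \<partial>lborel \<partial>\<Pi>\<^sub>M i\<in>I. lborel)"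
  proof (rule nn_integral_cong)
    fix f :: "'n \<Rightarrow> real"
    have eq: "?T (\<chi> i. (f(m := y)) i) = (\<chi> i. (f(m := y + c * f n)) i)" for y
      using mn by (auto simp: vec_eq_iff)
    have [measurable]: "(\<lambda>y. \<chi> i. (f(m := y)) i) \<in> measurable borel (borel :: (real ^ 'n) measure)"
    proof (rule borel_measurable_vec_lambda)
      fix i show "(\<lambda>y. (f(m := y)) i) \<in> borel_measurable borel" by (cases "i = m") auto
    qed
    show "(\<integral>\<^sup>+y. k (?T (\<chi> i. (f(m := y)) i)) \<partial>lborel) = (\<integral>\<^sup>+y. k (\<chi> i. (f(m := y)) i) \<partial>lborel)"
      unfolding eq by (rule nn_integral_lborel_translate[of "\<lambda>y. k (\<chi> i. (f(m := y)) i)"]) measurable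
  qed
  also have "\<dots> = (\<integral>\<^sup>+x. k x \<partial>lborel)" by (rule split[symmetric]) measurable
  finally show ?thesis .
qed

text \<open>The change of variables theorems of \<open>HOL-Analysis\<close> require a well-ordered index type.\<close>

lemma nn_integral_lborel_matrix:
  fixes A :: "real ^ 'n::finite ^ 'n" and k :: "real ^ 'n \<Rightarrow> ennreal"
  assumes "det A \<noteq> 0" "k \<in> borel_measurable borel"
  shows "(\<integral>\<^sup>+x. k x \<partial>lborel) = ennreal \<bar>det A\<bar> * (\<integral>\<^sup>+x. k (A *v x) \<partial>lborel)"
proof -
  \<comment> \<open>The quantifier over \<open>k\<close> lets the product case apply the hypothesis
    on \<open>B\<close> to \<open>k\<close> composed with \<open>A\<close>. The premise on the
    determinant makes the zero-row case vacuous.\<close>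
  define P where "P A \<longleftrightarrow> (det A \<noteq> 0 \<longrightarrow> (\<forall>k\<in>borel_measurable borel.
    (\<integral>\<^sup>+x. k x \<partial>lborel) = ennreal \<bar>det A\<bar> * (\<integral>\<^sup>+x. k (A *v x) \<partial>lborel)))" for A :: "real ^ 'n ^ 'n"
  have "P A"
  proof (rule induct_matrix_elementary)
    fix A B :: "real ^ 'n ^ 'n" assume A: "P A" and B: "P B"
    show "P (A ** B)" unfolding P_def
    proof (intro impI ballI)
      assume "det (A ** B) \<noteq> 0"
      then have d: "det A \<noteq> 0" "det B \<noteq> 0" by (auto simp: det_mul)
      fix k :: "real ^ 'n \<Rightarrow> ennreal" assume k[measurable]: "k \<in> borel_measurable borel"
      have "(\<integral>\<^sup>+x. k x \<partial>lborel) = ennreal \<bar>det A\<bar> * (\<integral>\<^sup>+x. k (A *v x) \<partial>lborel)"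
        using A d k unfolding P_def by blast
      also have "(\<integral>\<^sup>+x. k (A *v x) \<partial>lborel) = ennreal \<bar>det B\<bar> * (\<integral>\<^sup>+x. k (A *v (B *v x)) \<partial>lborel)"
      proof -
        have "(\<lambda>x. k (A *v x)) \<in> borel_measurable borel" by measurable
        then show ?thesis using B d unfolding P_def by blast
      qed
      finally show "(\<integral>\<^sup>+x. k x \<partial>lborel) = ennreal \<bar>det (A ** B)\<bar> * (\<integral>\<^sup>+x. k ((A ** B) *v x) \<partial>lborel)"
        by (simp add: det_mul abs_mult ennreal_mult mult.assoc matrix_vector_mul_assoc)
    qed
  next
    fix A :: "real ^ 'n ^ 'n" and i assume "row i A = 0"
    then show "P A" unfolding P_def using det_zero_row(1) by blast
  next
    fix A :: "real ^ 'n ^ 'n" assume 0: "\<And>i j. i \<noteq> j \<Longrightarrow> A $ i $ j = 0"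
    show "P A" unfolding P_def
    proof (intro impI ballI)
      assume d: "det A \<noteq> 0"
      fix k :: "real ^ 'n \<Rightarrow> ennreal" assume k[measurable]: "k \<in> borel_measurable borel"
      have det: "det A = (\<Prod>i\<in>UNIV. A $ i $ i)" by (rule det_diagonal) (rule 0)
      have Ax: "A *v x = (\<chi> i. A $ i $ i * x $ i)" for x
      proof -
        have "(\<Sum>j\<in>UNIV. A $ i $ j * x $ j) = (\<Sum>j\<in>UNIV. if j = i then A $ i $ i * x $ i else 0)" for i
          by (rule sum.cong) (auto simp: 0)
        then show ?thesis by (simp add: matrix_vector_mult_def)
      qed
      \<comment> \<open>A coefficient for each basis vector, as
        \<open>lborel_affine_euclidean\<close> expects; on \<open>axis i 1\<close> it is the
        diagonal entry.\<close>
      define c where "c b = (\<Sum>i\<in>UNIV. A $ i $ i * b $ i)" for b :: "real ^ 'n"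
      have c: "c (axis i 1) = A $ i $ i" for i
      proof -
        have "c (axis i 1) = (\<Sum>j\<in>UNIV. if j = i then A $ i $ i else 0)"
          unfolding c_def by (rule sum.cong) (auto simp: axis_def)
        then show ?thesis by simp
      qed
      have c0: "c j \<noteq> 0" if "j \<in> Basis" for j
        using that d unfolding det by (auto simp: Basis_vec_def c)
      have T: "0 + (\<Sum>j\<in>Basis. (c j * (x \<bullet> j)) *\<^sub>R j) = A *v x" for x
      proof (rule euclidean_eqI)
        fix b :: "real ^ 'n" assume b: "b \<in> Basis"
        then obtain i where i: "b = axis i 1" by (auto simp: Basis_vec_def)
        have "(0 + (\<Sum>j\<in>Basis. (c j * (x \<bullet> j)) *\<^sub>R j)) \<bullet> b = c b * (x \<bullet> b)"
          using b by simp
        then show "(0 + (\<Sum>j\<in>Basis. (c j * (x \<bullet> j)) *\<^sub>R j)) \<bullet> b = (A *v x) \<bullet> b"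
          unfolding Ax i by (simp add: c inner_axis)
      qed
      have "(\<Prod>j\<in>Basis. \<bar>c j\<bar>) = \<bar>det A\<bar>"
        by (simp add: prod_Basis_vec c det abs_prod)
      then have L: "(lborel :: (real ^ 'n) measure) = density (distr lborel borel ((*v) A)) (\<lambda>_. ennreal \<bar>det A\<bar>)"
        using lborel_affine_euclidean[of c 0] c0 unfolding T by simp
      have [measurable]: "(*v) A \<in> borel_measurable borel" by measurable
      show "(\<integral>\<^sup>+x. k x \<partial>lborel) = ennreal \<bar>det A\<bar> * (\<integral>\<^sup>+x. k (A *v x) \<partial>lborel)"
        by (subst L) (simp add: nn_integral_density nn_integral_distr nn_integral_cmult)
    qed
  next
    fix m n :: 'n assume mn: "m \<noteq> n"
    let ?p = "Transposition.transpose m n"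
    let ?B = "(\<chi> i j. mat 1 $ i $ ?p j) :: real ^ 'n ^ 'n"
    show "P ?B" unfolding P_def
    proof (intro impI ballI)
      fix k :: "real ^ 'n \<Rightarrow> ennreal" assume k[measurable]: "k \<in> borel_measurable borel"
      have "det ?B = of_int (sign ?p) * det (mat 1 :: real ^ 'n ^ 'n)"
        by (rule det_permute_columns) (simp add: permutes_swap_id)
      then have det: "\<bar>det ?B\<bar> = 1" by (simp add: sign_swap_id mn)
      have Bx: "?B *v x = (\<chi> i. x $ ?p i)" for x
      proof -
        have "(\<Sum>j\<in>UNIV. mat 1 $ i $ ?p j * x $ j) = (\<Sum>j\<in>UNIV. if j = ?p i then x $ ?p i else 0)" for i
          by (rule sum.cong) (auto simp: mat_def)
        then show ?thesis by (simp add: matrix_vector_mult_def)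
      qed
      have "(\<integral>\<^sup>+x. k x \<partial>lborel) = (\<integral>\<^sup>+x. k x \<partial>distr lborel borel (\<lambda>x. \<chi> i. x $ ?p i))"
        by (simp add: lborel_permute_coordinates)
      also have "\<dots> = (\<integral>\<^sup>+x. k (?B *v x) \<partial>lborel)"
        unfolding Bx by (rule nn_integral_distr) measurable
      finally show "(\<integral>\<^sup>+x. k x \<partial>lborel) = ennreal \<bar>det ?B\<bar> * (\<integral>\<^sup>+x. k (?B *v x) \<partial>lborel)"
        using det by simp
    qed
  next
    fix m n :: 'n and c :: real assume mn: "m \<noteq> n"
    let ?B = "(\<chi> i j. if i = m \<and> j = n then c else of_bool (i = j)) :: real ^ 'n ^ 'n"
    show "P ?B" unfolding P_def
    proof (intro impI ballI)
      fix k :: "real ^ 'n \<Rightarrow> ennreal" assume k[measurable]: "k \<in> borel_measurable borel"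
      have "?B = (\<chi> i. if i = m then row m (mat 1) + c *s row n (mat 1) else row i (mat 1))"
        using mn by (auto simp: vec_eq_iff row_def mat_def)
      then have det: "det ?B = 1"
        using det_row_operation[OF mn, of "mat 1 :: real ^ 'n ^ 'n" c] by simp
      have Bx: "?B *v x = (\<chi> i. if i = m then x $ m + c * x $ n else x $ i)" for x
      proof -
        have "(\<Sum>j\<in>UNIV. (if i = m \<and> j = n then c else of_bool (i = j)) * x $ j)
          = (\<Sum>j\<in>UNIV. (if j = i then x $ i else 0) + (if j = n then of_bool (i = m) * c * x $ n else 0))" for i
          using mn by (intro sum.cong) auto
        then show ?thesis by (auto simp: matrix_vector_mult_def sum.distrib vec_eq_iff)
      qed
      show "(\<integral>\<^sup>+x. k x \<partial>lborel) = ennreal \<bar>det ?B\<bar> * (\<integral>\<^sup>+x. k (?B *v x) \<partial>lborel)"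
        unfolding det Bx using nn_integral_lborel_shear[OF k mn, of c] by simp
    qed
  qed
  then show ?thesis using assms unfolding P_def by blast
qed

text \<open>The determinant is a polynomial in \<open>a\<close>. It is not the zero polynomial,
  since \<open>A + mat a\<close> is injective once \<open>a\<close> exceeds a bound for the operator
  norm of \<open>A\<close>.\<close>

lemma finite_det_add_mat_eq_0: "finite {a. det (A + mat a :: real ^ 'n::finite ^ 'n) = 0}"
proof -
  define q where "q = (\<Sum>p | p permutes (UNIV :: 'n set).
     [:of_int (sign p):] * (\<Prod>i\<in>UNIV. [:A $ i $ p i, if i = p i then 1 else 0:]))"
  have q: "poly q a = det (A + mat a)" for a
    unfolding q_def det_def poly_sum poly_mult poly_prod
    by (intro sum.cong prod.cong arg_cong2[where f="(*)"]) (auto simp: mat_def)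
  \<comment> \<open>The witness of a nonzero value is \<open>B + 1\<close>: a kernel vector would
    satisfy (B + 1) |x| \<le> B |x|.\<close>
  obtain B where B: "\<And>x. norm (A *v x) \<le> B * norm x"
    using linear_bounded[OF matrix_vector_mul_linear[of A]] by auto
  have "det (A + mat (B + 1)) \<noteq> 0"
  proof -
    have "x = 0" if "(A + mat (B + 1)) *v x = 0" for x
    proof -
      have "mat (B + 1) *v x = (B + 1) *\<^sub>R x"
      proof -
        have "(\<Sum>j\<in>UNIV. (if i = j then B + 1 else 0) * x $ j) = (\<Sum>j\<in>UNIV. if j = i then (B + 1) * x $ i else 0)" for i
          by (rule sum.cong) auto
        then show ?thesis by (simp add: matrix_vector_mult_def mat_def vec_eq_iff)
      qed
      then have "A *v x = - ((B + 1) *\<^sub>R x)"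
        using that by (simp add: matrix_vector_mult_add_rdistrib eq_neg_iff_add_eq_0)
      then have "\<bar>B + 1\<bar> * norm x \<le> B * norm x"
        using B[of x] by simp
      moreover have "(B + 1) * norm x \<le> \<bar>B + 1\<bar> * norm x" by (intro mult_right_mono) auto
      ultimately have "(B + 1) * norm x \<le> B * norm x" by (rule order_trans[rotated])
      then have "norm x \<le> 0" unfolding distrib_right by linarith
      then show "x = 0" by simp
    qed
    then have "\<exists>C. C ** (A + mat (B + 1)) = mat 1"
      unfolding matrix_left_invertible_ker by blast
    then have "invertible (A + mat (B + 1))"
      by (simp add: invertible_left_inverse)
    then show ?thesis by (simp add: invertible_det_nz)
  qed
  then have "q \<noteq> 0" using q[of "B + 1"] by auto
  then show ?thesis using poly_roots_finite[of q] by (simp add: q)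
qed

text \<open>Averaging over translations by \<open>mat a\<close>: every line in this direction meets
  the singular matrices in finitely many points, so Tonelli makes the average of the translated
  measures 0, and all of them are equal.\<close>

lemma AE_det_nonzero: "AE A in lborel. det (A :: real ^ 'n::finite ^ 'n) \<noteq> 0"
proof -
  define S where "S = {A :: real ^ 'n ^ 'n. det A = 0}"
  have S[measurable]: "S \<in> sets borel"
  proof -
    have "(\<lambda>A::real ^ 'n ^ 'n. det A) \<in> borel_measurable borel" by measurable
    from measurable_sets[OF this, of "{0}"] show ?thesis by (simp add: S_def vimage_def)
  qed
  have [measurable]: "(mat :: real \<Rightarrow> real ^ 'n ^ 'n) \<in> borel_measurable borel"
    unfolding mat_def
  proof (intro borel_measurable_vec_lambda)
    fix i j :: 'n show "(\<lambda>x::real. if i = j then x else 0) \<in> borel_measurable borel"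
      by (cases "i = j") auto
  qed
  let ?I = "{0..1::real}"
  \<comment> \<open>The interval has length 1, so averaging over it leaves the measure
    unchanged.\<close>
  have "emeasure lborel S = (\<integral>\<^sup>+a. indicator ?I a * emeasure lborel S \<partial>lborel)"
    by (simp add: nn_integral_multc)
  also have "\<dots> = (\<integral>\<^sup>+a. \<integral>\<^sup>+A. indicator ?I a * indicator S (A + mat a) \<partial>lborel \<partial>lborel)"
  proof (rule nn_integral_cong)
    fix a :: real
    have "(\<integral>\<^sup>+A. indicator S (A + mat a) \<partial>lborel) = (\<integral>\<^sup>+A. indicator S A \<partial>lborel)"
      by (rule nn_integral_lborel_translate) measurable
    then show "indicator ?I a * emeasure lborel S = (\<integral>\<^sup>+A. indicator ?I a * indicator S (A + mat a) \<partial>lborel)"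
      by (simp add: nn_integral_cmult)
  qed
  also have "\<dots> = (\<integral>\<^sup>+A. \<integral>\<^sup>+a. indicator ?I a * indicator S (A + mat a) \<partial>lborel \<partial>lborel)"
    by (rule lborel_pair.Fubini') measurable
  also have "\<dots> = integral\<^sup>N lborel (\<lambda>A :: real ^ 'n ^ 'n. integral\<^sup>N lborel (\<lambda>a :: real. 0))"
  proof (rule nn_integral_cong, rule nn_integral_cong_AE)
    fix A :: "real ^ 'n ^ 'n"
    have "{a. det (A + mat a) = 0} \<in> null_sets lborel"
      by (rule finite_imp_null_set_lborel) (rule finite_det_add_mat_eq_0)
    from AE_not_in[OF this]
    show "AE a in lborel. indicator ?I a * indicator S (A + mat a) = (0::ennreal)"
      by eventually_elim (simp add: S_def)
  qed
  finally have "emeasure lborel S = 0" by simp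
  then have "S \<in> null_sets lborel" using S by auto
  from AE_not_in[OF this] show ?thesis by (simp add: S_def)
qed

text \<open>In the Leibniz sum a permutation moving \<open>None\<close> sends some
  \<open>Some i\<close> to \<open>None\<close> and picks up a zero entry. The others are the
  permutations of the \<open>Some\<close> indices, with the same sign.\<close>

lemma det_option_block:
  fixes C :: "real ^ 'n::finite option ^ 'n option"
  assumes C: "\<And>i. C $ Some i $ None = 0"
  shows "det C = C $ None $ None * det (\<chi> i j. C $ Some i $ Some j)"
proof -
  let ?t = "\<lambda>p. of_int (sign p) * (\<Prod>i\<in>UNIV. C $ i $ p i)"
  let ?F = "map_permutation UNIV Some :: ('n \<Rightarrow> 'n) \<Rightarrow> _"
  have bS: "bij_betw Some UNIV (range Some :: 'n option set)"
    by (simp add: bij_betw_def)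
  have F_Some: "?F q (Some i) = Some (q i)" for q i
    by (simp add: map_permutation_def restrict_id_def)
  have F_None: "?F q None = None" for q
    by (simp add: map_permutation_def restrict_id_def)
  have sub: "{p. p permutes range Some} \<subseteq> {p. p permutes (UNIV :: 'n option set)}"
    by (auto intro: permutes_subset)
  have "det C = sum ?t {p. p permutes (UNIV :: 'n option set)}"
    by (rule det_def)
  also have "\<dots> = sum ?t {p. p permutes (range Some :: 'n option set)}"
  proof (rule sum.mono_neutral_right[OF _ sub])
    show "finite {p. p permutes (UNIV :: 'n option set)}" by (simp add: finite_permutations)
    show "\<forall>p\<in>{p. p permutes UNIV} - {p. p permutes range Some}. ?t p = 0"
    proof
      fix p :: "'n option \<Rightarrow> 'n option"
      assume "p \<in> {p. p permutes UNIV} - {p. p permutes range Some}"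
      then have p: "p permutes UNIV" "\<not> p permutes range Some" by auto
      have "p None \<noteq> None"
      proof
        assume "p None = None"
        then have "x \<notin> range Some \<Longrightarrow> p x = x" for x
          by (cases x) auto
        then have "p permutes range Some"
          using p(1) unfolding permutes_def by blast
        with p show False by simp
      qed
      obtain x where x: "p x = None" using p(1) by (metis permutes_univ)
      with \<open>p None \<noteq> None\<close> obtain i where "x = Some i" by (cases x) auto
      with x have "C $ Some i $ p (Some i) = 0" by (simp add: C)
      then have "(\<Prod>i\<in>UNIV. C $ i $ p i) = 0"
        by (intro prod_zero) auto
      then show "?t p = 0" by simp
    qed
  qed
  also have "\<dots> = (\<Sum>q | q permutes (UNIV :: 'n set). C $ None $ None * (of_int (sign q) * (\<Prod>i\<in>UNIV. C $ Some i $ Some (q i))))"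
  proof (rule sum.reindex_bij_witness[where i="?F" and j="\<lambda>p i. the (p (Some i))"])
    fix p :: "'n option \<Rightarrow> 'n option" assume "p \<in> {p. p permutes range Some}"
    then have p: "p permutes range Some" by simp
    define q where "q = (\<lambda>i. the (p (Some i)))"
    have pS: "p (Some i) = Some (q i)" for i
      using permutes_in_image[OF p, of "Some i"] by (auto simp: q_def)
    have pN: "p None = None" using p by (auto simp: permutes_def)
    show Fq: "?F (\<lambda>i. the (p (Some i))) = p"
    proof
      fix x show "?F (\<lambda>i. the (p (Some i))) x = p x"
        by (cases x) (simp_all add: F_Some F_None pS pN)
    qed
    have "bij q"
    proof (rule bijI)
      show "inj q" using permutes_inj[OF p] pS by (metis injD injI option.inject)
      show "surj q"
        unfolding surj_def
      proof
        fix y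
        obtain x where x: "p x = Some y" using permutes_surj[OF p] by (metis surjD)
        then obtain i where "x = Some i" using pN by (cases x) auto
        then show "\<exists>x. y = q x" using x pS by auto
      qed
    qed
    then have q: "q permutes UNIV" by (intro bij_imp_permutes) auto
    then show "(\<lambda>i. the (p (Some i))) \<in> {q. q permutes UNIV}" by (simp add: q_def)
    have "sign p = sign q"
      using sign_map_permutation[of Some UNIV q] q Fq by (simp add: q_def)
    then show "C $ None $ None * (of_int (sign (\<lambda>i. the (p (Some i)))) * (\<Prod>i\<in>UNIV. C $ Some i $ Some (the (p (Some i))))) = ?t p"
      by (simp add: prod_UNIV_option pN pS q_def[symmetric])
  next
    fix q :: "'n \<Rightarrow> 'n" assume "q \<in> {q. q permutes UNIV}"
    then show "?F q \<in> {p. p permutes range Some}"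
      using map_permutation_permutes[OF bS] by simp
    show "(\<lambda>i. the (?F q (Some i))) = q" by (simp add: F_Some)
  qed
  also have "\<dots> = C $ None $ None * det (\<chi> i j. C $ Some i $ Some j)"
    by (simp add: det_def sum_distrib_left)
  finally show ?thesis .
qed

text \<open>Subtracting the column of xi_(d+1) from the others leaves the differences and clears the
  ones. In transposed form \<open>S\<close> adds row \<open>None\<close> to the other rows, and
  \<open>B\<close> has the rows \<open>y $ l\<close> followed by 0, with last row \<open>v\<close>
  followed by 1.\<close>

lemma rho_shear_snoc:
  fixes y :: "real ^ 'n::finite ^ 'n"
  shows "rho (shear_snoc (y, v)) = det y"
proof -
  define M where "M = ((\<chi> i j. case i of None \<Rightarrow> 1 | Some k \<Rightarrow> shear_snoc (y, v) $ j $ k) :: real ^ 'n option ^ 'n option)"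
  define S where "S = ((\<chi> i j. if j = None then 1 else of_bool (i = j)) :: real ^ 'n option ^ 'n option)"
  define B where "B = ((\<chi> i j. case j of None \<Rightarrow> of_bool (i = None)
      | Some k \<Rightarrow> (case i of None \<Rightarrow> v $ k | Some l \<Rightarrow> y $ l $ k)) :: real ^ 'n option ^ 'n option)"
  have "transpose M = S ** B"
  proof -
    have "transpose M $ i $ j = (S ** B) $ i $ j" for i j
      by (cases i; cases j)
        (simp_all add: transpose_def M_def S_def B_def matrix_matrix_mult_def shear_snoc_def sum_UNIV_option if_distrib
          cong: if_cong)
    then show ?thesis by (simp add: vec_eq_iff)
  qed
  then have "det M = det S * det B" by (metis det_transpose det_mul)
  also have "det B = det y"
    by (subst det_option_block) (auto simp: B_def vec_eq_iff)
  also have "det S = det (transpose S)" by simp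
  also have "\<dots> = det (mat 1 :: real ^ 'n ^ 'n)"
    by (subst det_option_block) (auto simp: S_def transpose_def mat_def of_bool_def eq_commute intro!: arg_cong[where f=det])
  finally show ?thesis by (simp add: rho_def M_def)
qed

subsection \<open>The change of variables in frequency space\<close>

lemma det_scaleR: "det (c *\<^sub>R A :: real ^ 'n::finite ^ 'n) = c ^ CARD('n) * det A"
  unfolding det_def by (simp add: prod.distrib sum_distrib_left mult.left_commute)

definition sq_norms :: "real ^ 'm ^ 'n \<Rightarrow> real ^ 'n::finite" where
  "sq_norms y = (\<chi> i. (norm (y $ i))\<^sup>2)"

text \<open>The second component is the vector of the \<open>|\<xi>\<^sub>i|\<^sup>2 - |\<xi>\<^sub>d\<^sub>+\<^sub>1|\<^sup>2\<close>, where
  \<open>\<xi>\<^sub>i = y\<^sub>i + v\<close> and \<open>\<xi>\<^sub>d\<^sub>+\<^sub>1 = v\<close>; it is affine in \<open>v\<close>.\<close>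

definition phase_map :: "(real ^ 'n ^ 'n) \<times> (real ^ 'n) \<Rightarrow> (real ^ 'n::finite ^ 'n) \<times> (real ^ 'n)" where
  "phase_map = (\<lambda>(y, v). (y, sq_norms y + (2 *\<^sub>R y) *v v))"

text \<open>Cramer's rule for the equation \<open>(2 *\<^sub>R y) *v v = w - sq_norms y\<close>. The
  explicit formula yields measurability; for singular \<open>y\<close> division by zero gives the
  default value 0.\<close>

definition phase_inverse :: "(real ^ 'n ^ 'n) \<times> (real ^ 'n) \<Rightarrow> (real ^ 'n::finite ^ 'n) \<times> (real ^ 'n)" where
  "phase_inverse = (\<lambda>(y, w). (y, \<chi> k. det (\<chi> i j. if j = k then (w - sq_norms y) $ i else (2 *\<^sub>R y) $ i $ j) / det (2 *\<^sub>R y)))"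

lemma phase_inverse_phase_map:
  assumes "det (fst p) \<noteq> 0"
  shows "phase_inverse (phase_map p) = p"
proof -
  obtain y v where p: "p = (y, v)" by (cases p)
  have "det (2 *\<^sub>R y) \<noteq> 0" using assms by (simp add: p det_scaleR)
  then have "(\<chi> k. det (\<chi> i j. if j = k then ((2 *\<^sub>R y) *v v) $ i else (2 *\<^sub>R y) $ i $ j) / det (2 *\<^sub>R y)) = v"
    unfolding cramer_lemma by (simp add: vec_eq_iff)
  moreover have "sq_norms y + (2 *\<^sub>R y) *v v - sq_norms y = (2 *\<^sub>R y) *v v" by simp
  ultimately show ?thesis by (simp only: p phase_map_def phase_inverse_def prod.case)
qed

lemma fst_phase_map[simp]: "fst (phase_map p) = fst p"
  by (simp add: phase_map_def case_prod_beta)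

lemma snd_phase_map_nth: "snd (phase_map (y, v)) $ i = (norm (y $ i + v))\<^sup>2 - (norm v)\<^sup>2"
  by (simp add: phase_map_def sq_norms_def matrix_vector_mul_component power2_norm_eq_inner
      inner_add_left inner_add_right inner_commute algebra_simps)

lemma sq_norms_measurable[measurable (raw)]:
  fixes f :: "'c \<Rightarrow> real ^ 'm::finite ^ 'n::finite"
  assumes [measurable]: "f \<in> borel_measurable M"
  shows "(\<lambda>x. sq_norms (f x)) \<in> borel_measurable M"
  unfolding sq_norms_def by measurable

lemma phase_map_measurable[measurable]: "phase_map \<in> borel_measurable borel"
  unfolding phase_map_def case_prod_beta borel_prod[symmetric] by measurable

lemma phase_inverse_measurable[measurable]:
  "(phase_inverse :: (real ^ 'n::finite ^ 'n) \<times> (real ^ 'n) \<Rightarrow> _) \<in> borel_measurable borel"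
proof -
  have [measurable]: "(\<lambda>q :: (real ^ 'n ^ 'n) \<times> (real ^ 'n). \<chi> i j. if j = k then (snd q - sq_norms (fst q)) $ i else (2 *\<^sub>R fst q) $ i $ j)
      \<in> borel_measurable (borel \<Otimes>\<^sub>M borel)" (is "?f \<in> _") for k :: 'n
  proof (intro borel_measurable_vec_lambda)
    fix i j :: 'n
    show "(\<lambda>q :: (real ^ 'n ^ 'n) \<times> (real ^ 'n). if j = k then (snd q - sq_norms (fst q)) $ i else (2 *\<^sub>R fst q) $ i $ j)
        \<in> borel_measurable (borel \<Otimes>\<^sub>M borel)"
      by (cases "j = k") simp_all
  qed
  show ?thesis
    unfolding phase_inverse_def case_prod_beta borel_prod[symmetric] by measurable
qed

text \<open>This is |det (2 y)|: the derivative of \<open>phase_map\<close> is block triangular,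
  with the identity in the \<open>y\<close> block.\<close>

definition phase_jacobian :: "(real ^ 'n ^ 'n) \<times> (real ^ 'n) \<Rightarrow> real" where
  "phase_jacobian p = 2 ^ CARD('n) * \<bar>det (fst p :: real ^ 'n::finite ^ 'n)\<bar>"

lemma phase_jacobian_measurable[measurable]: "phase_jacobian \<in> borel_measurable borel"
  unfolding phase_jacobian_def borel_prod[symmetric] by measurable

lemma phase_jacobian_nonneg: "phase_jacobian p \<ge> 0"
  by (simp add: phase_jacobian_def)

text \<open>For each regular \<open>y\<close> this is the affine substitution with matrix 2 y in the
  second variable; singular \<open>y\<close> form a null set. Stated as an image measure, it
  transfers integrability and complex integrals too.\<close>

lemma distr_phase_map:
  "distr (density lborel (\<lambda>p. ennreal (phase_jacobian p))) borel phase_map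
     = (lborel :: ((real ^ 'n::finite ^ 'n) \<times> (real ^ 'n)) measure)"
proof (rule measure_eqI)
  let ?D = "density lborel (\<lambda>p. ennreal (phase_jacobian p)) :: ((real ^ 'n ^ 'n) \<times> (real ^ 'n)) measure"
  fix S :: "((real ^ 'n ^ 'n) \<times> (real ^ 'n)) set" assume "S \<in> sets (distr ?D borel phase_map)"
  then have S: "S \<in> sets borel" by simp
  then have [measurable]: "S \<in> sets (borel \<Otimes>\<^sub>M borel)" unfolding borel_prod .
  have "emeasure (distr ?D borel phase_map) S = (\<integral>\<^sup>+q. indicator S q \<partial>distr ?D borel phase_map)"
    using S by simp
  also have "\<dots> = (\<integral>\<^sup>+p. indicator S (phase_map p) \<partial>?D)"
    using S by (intro nn_integral_distr) auto
  also have "\<dots> = (\<integral>\<^sup>+p. ennreal (phase_jacobian p) * indicator S (phase_map p) \<partial>lborel)"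
    using S by (intro nn_integral_density) auto
  also have "\<dots> = (\<integral>\<^sup>+p. ennreal (2 ^ CARD('n) * \<bar>det (fst p)\<bar>) *
      indicator S (fst p, sq_norms (fst p) + (2 *\<^sub>R fst p) *v snd p) \<partial>(lborel \<Otimes>\<^sub>M lborel))"
    unfolding lborel_prod phase_jacobian_def phase_map_def case_prod_beta ..
  also have "\<dots> = (\<integral>\<^sup>+y. \<integral>\<^sup>+v. ennreal (2 ^ CARD('n) * \<bar>det y\<bar>) *
      indicator S (y, sq_norms y + (2 *\<^sub>R y) *v v) \<partial>lborel \<partial>lborel)"
    by (subst lborel.nn_integral_fst[symmetric]) auto
  also have "\<dots> = (\<integral>\<^sup>+y. \<integral>\<^sup>+w. indicator S (y, w) \<partial>lborel \<partial>lborel)"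
  proof (rule nn_integral_cong_AE)
    show "AE y in lborel. (\<integral>\<^sup>+v. ennreal (2 ^ CARD('n) * \<bar>det y\<bar>) *
        indicator S (y, sq_norms y + (2 *\<^sub>R y) *v v) \<partial>lborel) = (\<integral>\<^sup>+w. indicator S (y, w) \<partial>lborel)"
      using AE_det_nonzero
    proof eventually_elim
      case (elim y)
      have det: "det (2 *\<^sub>R y) \<noteq> 0" "\<bar>det (2 *\<^sub>R y)\<bar> = 2 ^ CARD('n) * \<bar>det y\<bar>"
        using elim by (simp_all add: det_scaleR abs_mult)
      have "(\<integral>\<^sup>+w. indicator S (y, w) \<partial>lborel) = (\<integral>\<^sup>+w. indicator S (y, w + sq_norms y) \<partial>lborel)"
        by (rule nn_integral_lborel_translate[symmetric]) measurable
      also have "\<dots> = ennreal \<bar>det (2 *\<^sub>R y)\<bar> * (\<integral>\<^sup>+v. indicator S (y, (2 *\<^sub>R y) *v v + sq_norms y) \<partial>lborel)"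
        by (rule nn_integral_lborel_matrix[OF det(1)]) measurable
      also have "\<dots> = (\<integral>\<^sup>+v. ennreal \<bar>det (2 *\<^sub>R y)\<bar> * indicator S (y, (2 *\<^sub>R y) *v v + sq_norms y) \<partial>lborel)"
        by (rule nn_integral_cmult[symmetric]) measurable
      finally show ?case unfolding det(2) by (simp add: add.commute)
    qed
  qed
  also have "\<dots> = (\<integral>\<^sup>+q. indicator S q \<partial>(lborel \<Otimes>\<^sub>M lborel))"
    by (rule lborel.nn_integral_fst) measurable
  also have "\<dots> = emeasure lborel S"
    using S by (simp add: lborel_prod)
  finally show "emeasure (distr ?D borel phase_map) S = emeasure lborel S" .
qed simp

section \<open>Multipliers and products of solutions\<close>

lemma rho_measurable[measurable]: "rho \<in> borel_measurable borel"
proof -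
  have "(\<lambda>\<xi>. \<chi> i j. case i of None \<Rightarrow> 1 | Some k \<Rightarrow> \<xi> $ j $ k) \<in>
     measurable (borel :: ((real ^ 'n) ^ 'n option) measure) (borel :: (real ^ 'n option ^ 'n option) measure)"
  proof (intro borel_measurable_vec_lambda)
    fix i j :: "'n option"
    show "(\<lambda>\<xi> :: (real ^ 'n) ^ 'n option. case i of None \<Rightarrow> 1 | Some k \<Rightarrow> \<xi> $ j $ k) \<in> borel_measurable borel"
      by (cases i) auto
  qed
  then show ?thesis unfolding rho_def[abs_def] by (rule det_measurable)
qed

text \<open>The chosen transform of \<open>U\<close> agrees with \<open>G\<close> off a null set,
  which the inverse transform does not see. Equality at every point is essential for the later
  restriction to a null subspace.\<close>

lemma fourier_multiplier_eq:
  fixes U :: "'a::euclidean_space \<Rightarrow> complex"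
  assumes U: "has_fourier_transform U G" and [measurable]: "m \<in> borel_measurable borel"
  shows "fourier_multiplier m U = inverse_fourier (\<lambda>\<xi>. m \<xi> * G \<xi>)"
proof
  fix x
  have F: "has_fourier_transform U (fourier_transform U)"
    unfolding fourier_transform_def by (rule someI[of "has_fourier_transform U"]) (rule U)
  have [measurable]: "G \<in> borel_measurable borel" "fourier_transform U \<in> borel_measurable borel"
    using U F unfolding has_fourier_transform_def by (auto dest: borel_measurable_integrable)
  have "AE \<xi> in lborel. cis (x \<bullet> \<xi>) * (m \<xi> * fourier_transform U \<xi>) = cis (x \<bullet> \<xi>) * (m \<xi> * G \<xi>)"
    using has_fourier_transform_unique[OF F U] by eventually_elim simp
  then have "(\<integral>\<xi>. cis (x \<bullet> \<xi>) * (m \<xi> * fourier_transform U \<xi>) \<partial>lborel) = (\<integral>\<xi>. cis (x \<bullet> \<xi>) * (m \<xi> * G \<xi>) \<partial>lborel)"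
    by (intro integral_cong_AE) measurable
  then show "fourier_multiplier m U x = inverse_fourier (\<lambda>\<xi>. m \<xi> * G \<xi>) x"
    unfolding fourier_multiplier_def inverse_fourier_def by simp
qed

lemma L2_norm_sq_plancherel:
  fixes f :: "'a::euclidean_space \<Rightarrow> complex"
  assumes "has_fourier_transform f g"
  shows "L2_norm_sq f = ennreal (1 / (2 * pi) ^ DIM('a)) * (\<integral>\<^sup>+\<xi>. ennreal ((norm (g \<xi>))\<^sup>2) \<partial>lborel)"
proof -
  have "L2_norm_sq f = (\<integral>\<^sup>+x. ennreal ((norm (inverse_fourier g x))\<^sup>2) \<partial>lborel)"
    unfolding L2_norm_sq_def
    using assms by (intro nn_integral_cong_AE) (auto simp: has_fourier_transform_def)
  then show ?thesis
    using plancherel_L1[of g] assms by (simp add: has_fourier_transform_def)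
qed

text \<open>The factors depend on separate variables, so the product of their integrals is one
  integral over all frequencies. At fixed times the evolution only adds a unimodular factor.\<close>

lemma has_fourier_transform_prod_schrodinger:
  fixes f :: "'n::finite \<Rightarrow> 'a::euclidean_space \<Rightarrow> complex"
  assumes g: "\<And>j. integrable lborel (fourier_transform (f j))"
  shows "has_fourier_transform (\<lambda>y. \<Prod>j\<in>UNIV. schrodinger_solution (f j) (y $ j) (t j))
    (\<lambda>\<xi>. cis (\<Sum>j\<in>UNIV. t j * (norm (\<xi> $ j))\<^sup>2) * (\<Prod>j\<in>UNIV. fourier_transform (f j) (\<xi> $ j)))"
proof -
  have [measurable]: "fourier_transform (f j) \<in> borel_measurable borel" for j
    using borel_measurable_integrable[OF g] by simp
  define h where "h y j \<eta> = cis (y $ j \<bullet> \<eta> + t j * (norm \<eta>)\<^sup>2) * fourier_transform (f j) \<eta>"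
    for y :: "'a ^ 'n" and j \<eta>
  have h: "integrable lborel (h y j)" for y j
    by (rule Bochner_Integration.integrable_bound[OF g[of j]]) (auto simp: h_def[abs_def] norm_mult)
  have h_prod: "(\<Prod>j\<in>UNIV. h y j (\<xi> $ j)) = cis (y \<bullet> \<xi>) *
      (cis (\<Sum>j\<in>UNIV. t j * (norm (\<xi> $ j))\<^sup>2) * (\<Prod>j\<in>UNIV. fourier_transform (f j) (\<xi> $ j)))" for y \<xi>
    by (simp add: h_def prod.distrib inner_vec_def mult.assoc[symmetric] cis_mult
        sum.distrib[symmetric] cis_sum[symmetric])
  show ?thesis
    unfolding has_fourier_transform_def
  proof (intro conjI AE_I2)
    \<comment> \<open>At \<open>y = 0\<close> the spatial exponential in \<open>h_prod\<close>
      equals 1.\<close>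
    show "integrable lborel (\<lambda>\<xi>. cis (\<Sum>j\<in>UNIV. t j * (norm (\<xi> $ j))\<^sup>2) * (\<Prod>j\<in>UNIV. fourier_transform (f j) (\<xi> $ j)))"
      using integral_vec_prod(1)[of "h 0"] h h_prod[of 0] by simp
    fix y :: "'a ^ 'n"
    have "(\<Prod>j\<in>UNIV. schrodinger_solution (f j) (y $ j) (t j))
        = (\<Prod>j\<in>(UNIV :: 'n set). complex_of_real (1 / (2 * pi) ^ DIM('a))) * (\<Prod>j\<in>UNIV. \<integral>\<eta>. h y j \<eta> \<partial>lborel)"
      unfolding schrodinger_solution_def h_def by (rule prod.distrib)
    also have "(\<Prod>j\<in>(UNIV :: 'n set). complex_of_real (1 / (2 * pi) ^ DIM('a))) = complex_of_real (1 / (2 * pi) ^ DIM('a ^ 'n))"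
      by (simp add: power_divide power_mult_distrib power_mult[symmetric] mult.commute)
    also have "(\<Prod>j\<in>UNIV. \<integral>\<eta>. h y j \<eta> \<partial>lborel) = (\<integral>\<xi>. (\<Prod>j\<in>UNIV. h y j (\<xi> $ j)) \<partial>lborel)"
      by (rule integral_vec_prod(2)[symmetric]) (rule h)
    finally show "(\<Prod>j\<in>UNIV. schrodinger_solution (f j) (y $ j) (t j)) =
      inverse_fourier (\<lambda>\<xi>. cis (\<Sum>j\<in>UNIV. t j * (norm (\<xi> $ j))\<^sup>2) * (\<Prod>j\<in>UNIV. fourier_transform (f j) (\<xi> $ j))) y"
      unfolding inverse_fourier_def h_prod .
  qed
qed

text \<open>The common shift \<open>v\<close> is paired with the sum of the positions, which is
  0.\<close>

lemma inner_zero_sum_ext_shear_snoc: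
  fixes x y :: "'a::real_inner ^ 'n::finite"
  shows "zero_sum_ext x \<bullet> shear_snoc (y, v) = x \<bullet> y"
  by (simp add: inner_vec_def sum_UNIV_option zero_sum_ext_def shear_snoc_def inner_add_right
      sum.distrib inner_sum_left inner_minus_left)

text \<open>As the times sum to 0, the last squared norm can be subtracted from each of the
  others.\<close>

lemma sum_zero_sum_ext_shear_snoc:
  fixes t v :: "real ^ 'n::finite"
  shows "(\<Sum>j\<in>UNIV. zero_sum_ext t $ j * (norm (shear_snoc (y, v) $ j))\<^sup>2) = t \<bullet> snd (phase_map (y, v))"
  by (simp add: inner_vec_def sum_UNIV_option zero_sum_ext_def shear_snoc_def snd_phase_map_nth
      right_diff_distrib sum_subtractf sum_distrib_right)

section \<open>Transport to difference variables and comparison of norms\<close>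

theorem corollary1p6:
  fixes f :: "'d::finite option \<Rightarrow> real ^ 'd \<Rightarrow> complex"
    and u :: "'d option \<Rightarrow> real ^ 'd \<Rightarrow> real \<Rightarrow> complex"
  assumes "\<And>j. \<exists>g. has_fourier_transform (f j) g"
    and "integrable lborel (\<lambda>\<xi> :: (real ^ 'd) ^ 'd option.
           complex_of_real (\<bar>rho \<xi>\<bar> powr (1/2)) * (\<Prod>j\<in>UNIV. fourier_transform (f j) (\<xi> $ j)))"
    and "\<And>j x t. u j x t = schrodinger_solution (f j) x t"
  shows "(\<integral>\<^sup>+ (x :: (real ^ 'd) ^ 'd, t :: real ^ 'd).
            ennreal ((norm (abs_rho_nabla_half
              (\<lambda>y. \<Prod>j\<in>UNIV. u j (y $ j) (zero_sum_ext t $ j))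
              (zero_sum_ext x)))\<^sup>2) \<partial>(lborel \<Otimes>\<^sub>M lborel)) =
         ennreal (1 / 2 ^ CARD('d)) * (\<Prod>j\<in>UNIV. L2_norm_sq (f j))"
proof -
  define g where "g j = fourier_transform (f j)" for j
  have g: "has_fourier_transform (f j) (g j)" for j
    unfolding g_def fourier_transform_def by (rule someI_ex[of "has_fourier_transform (f j)"]) (rule assms(1))
  have g_int: "integrable lborel (g j)" for j
    using g[of j] by (simp add: has_fourier_transform_def)
  have [measurable]: "g j \<in> borel_measurable borel" for j
    using borel_measurable_integrable[OF g_int] by simp
  define W where "W \<xi> = (\<Prod>j\<in>UNIV. g j (\<xi> $ j))" for \<xi>
  have [measurable]: "W \<in> borel_measurable borel" unfolding W_def by measurable
  define m where "m \<xi> = complex_of_real (\<bar>rho \<xi>\<bar> powr (1/2))" for \<xi> :: "(real ^ 'd) ^ 'd option"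
  have [measurable]: "m \<in> borel_measurable borel" unfolding m_def by measurable
  define K where "K p = m (shear_snoc p) * W (shear_snoc p)" for p
  have [measurable]: "K \<in> borel_measurable borel" unfolding K_def by measurable
  \<comment> \<open>The density of the image of \<open>K\<close> under \<open>phase_map\<close>:
    inverse substitution divided by the Jacobian, with value 0 where the Jacobian vanishes.\<close>
  define H where "H q = K (phase_inverse q) / complex_of_real (phase_jacobian q)" for q
  have [measurable]: "H \<in> borel_measurable borel" unfolding H_def by measurable
  let ?D = "density lborel (\<lambda>p. ennreal (phase_jacobian p)) :: ((real ^ 'd ^ 'd) \<times> (real ^ 'd)) measure"

  have m_shear: "m (shear_snoc p) = complex_of_real (\<bar>det (fst p)\<bar> powr (1/2))" for p
    by (cases p) (simp add: m_def rho_shear_snoc)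
  \<comment> \<open>Valid at every point: for singular \<open>fst p\<close> the weight makes
    \<open>K p\<close> vanish along with the Jacobian.\<close>
  have H_K: "phase_jacobian p *\<^sub>R H (phase_map p) = K p" for p
  proof (cases "det (fst p) = 0")
    case True then show ?thesis by (simp add: phase_jacobian_def K_def m_shear)
  next
    case False
    then have "phase_jacobian p \<noteq> 0" by (simp add: phase_jacobian_def)
    moreover have "phase_jacobian (phase_map p) = phase_jacobian p" by (simp add: phase_jacobian_def)
    ultimately show ?thesis
      unfolding H_def phase_inverse_phase_map[OF False] by (simp add: scaleR_conv_of_real)
  qed

  have "integrable (distr lborel borel shear_snoc) (\<lambda>\<xi>. m \<xi> * W \<xi>)"
    using assms(2) by (simp add: lborel_shear_snoc m_def W_def g_def)
  then have "integrable lborel K"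
    by (subst (asm) integrable_distr_eq) (auto simp: K_def[abs_def])
  then have "integrable ?D (\<lambda>p. H (phase_map p))"
    by (subst integrable_density) (auto simp: H_K phase_jacobian_nonneg)
  then have "integrable (distr ?D borel phase_map) H"
    by (subst integrable_distr_eq) auto
  then have H_int: "integrable lborel H" by (simp add: distr_phase_map)

  \<comment> \<open>The two substitutions turn the whole space-time phase into a single inner
    product with \<open>(x, t)\<close>, so times become Fourier variables alongside
    positions.\<close>
  have F: "abs_rho_nabla_half (\<lambda>y. \<Prod>j\<in>UNIV. u j (y $ j) (zero_sum_ext t $ j)) (zero_sum_ext x)
      = inverse_fourier H (x, t)" for x :: "(real ^ 'd) ^ 'd" and t :: "real ^ 'd"
  proof -
    define G where "G \<xi> = cis (\<Sum>j\<in>UNIV. zero_sum_ext t $ j * (norm (\<xi> $ j))\<^sup>2) * W \<xi>" for \<xi>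
    have [measurable]: "G \<in> borel_measurable borel" unfolding G_def by measurable
    have "has_fourier_transform (\<lambda>y. \<Prod>j\<in>UNIV. u j (y $ j) (zero_sum_ext t $ j)) G"
      using has_fourier_transform_prod_schrodinger[of f "\<lambda>j. zero_sum_ext t $ j"] g_int
      unfolding assms(3) G_def[abs_def] W_def g_def by simp
    then have "abs_rho_nabla_half (\<lambda>y. \<Prod>j\<in>UNIV. u j (y $ j) (zero_sum_ext t $ j)) (zero_sum_ext x)
        = inverse_fourier (\<lambda>\<xi>. m \<xi> * G \<xi>) (zero_sum_ext x)"
      unfolding abs_rho_nabla_half_def m_def[symmetric] by (subst fourier_multiplier_eq) auto
    also have "\<dots> = complex_of_real (1 / (2 * pi) ^ DIM((real ^ 'd) ^ 'd option)) *
        (\<integral>\<xi>. cis (zero_sum_ext x \<bullet> \<xi>) * (m \<xi> * G \<xi>) \<partial>lborel)"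
      by (simp add: inverse_fourier_def)
    also have "(\<integral>\<xi>. cis (zero_sum_ext x \<bullet> \<xi>) * (m \<xi> * G \<xi>) \<partial>lborel)
        = (\<integral>\<xi>. cis (zero_sum_ext x \<bullet> \<xi>) * (m \<xi> * G \<xi>) \<partial>distr lborel borel shear_snoc)"
      by (simp add: lborel_shear_snoc)
    also have "\<dots> = (\<integral>p. cis (zero_sum_ext x \<bullet> shear_snoc p) * (m (shear_snoc p) * G (shear_snoc p)) \<partial>lborel)"
      by (rule integral_distr) auto
    also have "\<dots> = (\<integral>p. phase_jacobian p *\<^sub>R (cis ((x, t) \<bullet> phase_map p) * H (phase_map p)) \<partial>lborel)"
    proof (rule Bochner_Integration.integral_cong[OF refl])
      fix p :: "(real ^ 'd ^ 'd) \<times> (real ^ 'd)"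
      obtain y v where p: "p = (y, v)" by (cases p)
      have ph: "(x, t) \<bullet> phase_map p = x \<bullet> y + t \<bullet> snd (phase_map p)"
        by (simp add: inner_prod_def p)
      have "cis (zero_sum_ext x \<bullet> shear_snoc p) * (m (shear_snoc p) * G (shear_snoc p))
         = cis ((x, t) \<bullet> phase_map p) * K p"
        unfolding ph unfolding p G_def K_def inner_zero_sum_ext_shear_snoc sum_zero_sum_ext_shear_snoc
        by (simp flip: cis_mult)
      then show "cis (zero_sum_ext x \<bullet> shear_snoc p) * (m (shear_snoc p) * G (shear_snoc p))
         = phase_jacobian p *\<^sub>R (cis ((x, t) \<bullet> phase_map p) * H (phase_map p))"
        by (simp flip: H_K)
    qed
    also have "\<dots> = (\<integral>p. cis ((x, t) \<bullet> phase_map p) * H (phase_map p) \<partial>?D)"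
      by (rule integral_density[symmetric]) (auto simp: phase_jacobian_nonneg)
    also have "\<dots> = (\<integral>q. cis ((x, t) \<bullet> q) * H q \<partial>distr ?D borel phase_map)"
      by (rule integral_distr[symmetric]) auto
    also have "complex_of_real (1 / (2 * pi) ^ DIM((real ^ 'd) ^ 'd option)) * \<dots> = inverse_fourier H (x, t)"
      by (simp add: inverse_fourier_def distr_phase_map algebra_simps)
    finally show ?thesis .
  qed

  have AE_det: "AE p in (lborel :: ((real ^ 'd ^ 'd) \<times> (real ^ 'd)) measure). det (fst p) \<noteq> 0"
    unfolding lborel_prod[symmetric]
  proof (rule lborel_pair.AE_pair_measure)
    show "{p \<in> space (lborel \<Otimes>\<^sub>M lborel). det (fst p :: real ^ 'd ^ 'd) \<noteq> 0}
        \<in> sets (lborel \<Otimes>\<^sub>M (lborel :: (real ^ 'd) measure))"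
      by measurable
    show "AE y in lborel. AE v in lborel. det (fst (y :: real ^ 'd ^ 'd, v :: real ^ 'd)) \<noteq> 0"
      using AE_det_nonzero by eventually_elim simp
  qed
  have "(\<integral>\<^sup>+q. ennreal ((norm (H q))\<^sup>2) \<partial>lborel) = (\<integral>\<^sup>+q. ennreal ((norm (H q))\<^sup>2) \<partial>distr ?D borel phase_map)"
    by (simp add: distr_phase_map)
  also have "\<dots> = (\<integral>\<^sup>+p. ennreal ((norm (H (phase_map p)))\<^sup>2) \<partial>?D)"
    by (rule nn_integral_distr) auto
  also have "\<dots> = (\<integral>\<^sup>+p. ennreal (phase_jacobian p) * ennreal ((norm (H (phase_map p)))\<^sup>2) \<partial>lborel)"
    by (rule nn_integral_density) auto
  \<comment> \<open>With J the Jacobian, J |H|^2 = |K|^2 / J. Here |K|^2 carries one power of |det|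
    and J = 2^d |det|, so the determinant cancels and 2^(-d) remains.\<close>
  also have "\<dots> = (\<integral>\<^sup>+p. ennreal (1 / 2 ^ CARD('d)) * ennreal ((norm (W (shear_snoc p)))\<^sup>2) \<partial>lborel)"
  proof (rule nn_integral_cong_AE, use AE_det in eventually_elim)
    case (elim p)
    define J where "J = phase_jacobian p"
    have J: "J = 2 ^ CARD('d) * \<bar>det (fst p)\<bar>" "J > 0"
      using elim by (simp_all add: J_def phase_jacobian_def)
    have "J * norm (H (phase_map p)) = norm (K p)"
      using H_K[of p] J(2) unfolding J_def[symmetric] by (metis norm_scaleR abs_of_pos)
    then have "J\<^sup>2 * (norm (H (phase_map p)))\<^sup>2 = (norm (K p))\<^sup>2"
      by (metis power_mult_distrib)
    also have "\<dots> = \<bar>det (fst p)\<bar> * (norm (W (shear_snoc p)))\<^sup>2"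
      by (simp add: K_def m_shear norm_mult power_mult_distrib powr_half_sqrt)
    also have "\<bar>det (fst p)\<bar> = J / 2 ^ CARD('d)" by (simp add: J)
    finally have "J * (J * (norm (H (phase_map p)))\<^sup>2) = J * (1 / 2 ^ CARD('d) * (norm (W (shear_snoc p)))\<^sup>2)"
      by (simp add: power2_eq_square mult.assoc)
    then have "J * (norm (H (phase_map p)))\<^sup>2 = 1 / 2 ^ CARD('d) * (norm (W (shear_snoc p)))\<^sup>2"
      using J(2) by (simp only: mult_cancel_left) simp
    then show ?case
      unfolding J_def[symmetric] using J(2) by (simp flip: ennreal_mult)
  qed
  also have "\<dots> = ennreal (1 / 2 ^ CARD('d)) * (\<integral>\<^sup>+p. ennreal ((norm (W (shear_snoc p)))\<^sup>2) \<partial>lborel)"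
    by (rule nn_integral_cmult) auto
  also have "(\<integral>\<^sup>+p. ennreal ((norm (W (shear_snoc p)))\<^sup>2) \<partial>lborel)
      = (\<integral>\<^sup>+\<xi>. ennreal ((norm (W \<xi>))\<^sup>2) \<partial>distr lborel borel shear_snoc)"
    by (rule nn_integral_distr[symmetric]) auto
  also have "\<dots> = (\<integral>\<^sup>+\<xi>. (\<Prod>j\<in>UNIV. ennreal ((norm (g j (\<xi> $ j)))\<^sup>2)) \<partial>lborel)"
    by (simp add: lborel_shear_snoc W_def prod_norm[symmetric] prod_power_distrib[symmetric] prod_ennreal)
  also have "\<dots> = (\<Prod>j\<in>UNIV. \<integral>\<^sup>+\<xi>. ennreal ((norm (g j \<xi>))\<^sup>2) \<partial>lborel)"
    by (rule nn_integral_vec_prod) measurable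
  finally have H_norm: "(\<integral>\<^sup>+q. ennreal ((norm (H q))\<^sup>2) \<partial>lborel)
    = ennreal (1 / 2 ^ CARD('d)) * (\<Prod>j\<in>UNIV. \<integral>\<^sup>+\<xi>. ennreal ((norm (g j \<xi>))\<^sup>2) \<partial>lborel)" .

  have "(\<integral>\<^sup>+ (x, t). ennreal ((norm (abs_rho_nabla_half
              (\<lambda>y. \<Prod>j\<in>UNIV. u j (y $ j) (zero_sum_ext t $ j)) (zero_sum_ext x)))\<^sup>2) \<partial>(lborel \<Otimes>\<^sub>M lborel))
      = (\<integral>\<^sup>+q. ennreal ((norm (inverse_fourier H q))\<^sup>2) \<partial>lborel)"
    unfolding F lborel_prod by (intro nn_integral_cong) auto
  also have "\<dots> = ennreal (1 / (2 * pi) ^ DIM((real ^ 'd ^ 'd) \<times> (real ^ 'd))) * (\<integral>\<^sup>+q. ennreal ((norm (H q))\<^sup>2) \<partial>lborel)"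
    by (rule plancherel_L1[OF H_int])
  also have "ennreal (1 / (2 * pi) ^ DIM((real ^ 'd ^ 'd) \<times> (real ^ 'd))) = (\<Prod>j\<in>(UNIV :: 'd option set). ennreal (1 / (2 * pi) ^ DIM(real ^ 'd)))"
  proof -
    \<comment> \<open>The d^2 + d variables provide one factor (2 pi)^(-d) for each of the d + 1
      norms.\<close>
    have "r ^ (n * n + n) = (r ^ n) ^ Suc n" for r :: real and n
      by (simp add: power_add power_mult mult.commute)
    then have "1 / (2 * pi) ^ DIM((real ^ 'd ^ 'd) \<times> (real ^ 'd)) = (1 / (2 * pi) ^ CARD('d)) ^ Suc CARD('d)"
      unfolding power_one_over by simp
    moreover have "(\<Prod>j\<in>(UNIV :: 'd option set). ennreal c) = ennreal (c ^ Suc CARD('d))" if "c \<ge> 0" for c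
      unfolding ennreal_power[OF that, symmetric] by simp
    ultimately show ?thesis by simp
  qed
  finally show ?thesis
    by (simp only: H_norm L2_norm_sq_plancherel[OF g] prod.distrib mult_ac)
qed

end
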